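(* Let $E$ be a complex Banach space and $V$ a bounded open balanced convex subset of $E$ containing $0$, and let $\mathcal{A}$ denote $\mathcal{A}_u(V)$, $\mathcal{A}_\infty(V)$ or $\mathcal{H}^\infty(V)$. Then $\mathcal{A}$ has the Daugavet property.
   Context: $\mathcal{H}^\infty(V)$ is the Banach algebra of all bounded holomorphic functions $f:V\to\mathbb{C}$ with norm $\|f\|=\sup_{x\in V}|f(x)|$. $\mathcal{A}_\infty(V)$ is the Banach algebra of those $f\in\mathcal{H}^\infty(V)$ which extend continuously to the closure $\overline{V}$, and $\mathcal{A}_u(V)$ is the closed subalgebra of those $f\in\mathcal{H}^\infty(V)$ which are uniformly continuous on $V$. A Banach space $X$ has the Daugavet property if $\|T+I\|=1+\|T\|$ for every rank-one bounded linear operator $T:X\to X$, where $I$ is the identity on $X$.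
   Formalization: E is assumed to be nonzero: for E = {0} one has V = {0}, each of the three algebras is the complex numbers, and T = -I is a rank-one operator with norm of T + I equal to 0 instead of 2. *)

theory Defs
  imports "HOL-Analysis.Analysis" "HOL-Library.Function_Algebras"
begin

section \<open>Complex Banach spaces\<close>

class complex_banach = banach +
  fixes scaleC :: "complex \<Rightarrow> 'a \<Rightarrow> 'a" (infixr "*\<^sub>C" 75)
  assumes scaleC_add_right: "a *\<^sub>C (x + y) = a *\<^sub>C x + a *\<^sub>C y"
    and scaleC_add_left: "(a + b) *\<^sub>C x = a *\<^sub>C x + b *\<^sub>C x"
    and scaleC_scaleC: "a *\<^sub>C (b *\<^sub>C x) = (a * b) *\<^sub>C x"
    and scaleR_scaleC: "r *\<^sub>R x = complex_of_real r *\<^sub>C x"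
    and norm_scaleC: "norm (a *\<^sub>C x) = cmod a * norm x"

instantiation complex :: complex_banach
begin

definition scaleC_complex :: "complex \<Rightarrow> complex \<Rightarrow> complex" where
  "scaleC_complex a x = a * x"

instance
  by standard (simp_all add: scaleC_complex_def algebra_simps scaleR_conv_of_real norm_mult)

end

definition balanced :: "'a::complex_banach set \<Rightarrow> bool" where
  "balanced V \<longleftrightarrow> (\<forall>c. \<forall>x\<in>V. cmod c \<le> 1 \<longrightarrow> c *\<^sub>C x \<in> V)"


section \<open>Algebras of bounded holomorphic functions\<close>

text \<open>
  A function is holomorphic if it has a complex-linear Frechet derivative at every point;
  \<^term>\<open>(f has_derivative D) (at x within V)\<close> already says that \<^term>\<open>D\<close> is bounded and
  real-linear.
\<close>

definition holomorphic :: "('a::complex_banach \<Rightarrow> complex) \<Rightarrow> 'a set \<Rightarrow> bool" where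
  "holomorphic f V \<longleftrightarrow>
     (\<forall>x\<in>V. \<exists>D. (f has_derivative D) (at x within V) \<and> (\<forall>c h. D (c *\<^sub>C h) = c * D h))"

text \<open>
  A function on \<^term>\<open>V\<close> is represented by its extension by zero to the whole space, so that
  equality of representatives is equality on \<^term>\<open>V\<close>. The values outside \<^term>\<open>V\<close> carry no
  information; in particular, the continuity conditions below only concern the restriction
  to \<^term>\<open>V\<close>.
\<close>

definition H_inf :: "'a::complex_banach set \<Rightarrow> ('a \<Rightarrow> complex) set" where
  "H_inf V = {f. holomorphic f V \<and> bounded (f ` V) \<and> (\<forall>x. x \<notin> V \<longrightarrow> f x = 0)}"

definition A_inf :: "'a::complex_banach set \<Rightarrow> ('a \<Rightarrow> complex) set" where
  "A_inf V = {f \<in> H_inf V. \<exists>g. continuous_on (closure V) g \<and> (\<forall>x\<in>V. g x = f x)}"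

definition A_u :: "'a::complex_banach set \<Rightarrow> ('a \<Rightarrow> complex) set" where
  "A_u V = {f \<in> H_inf V. uniformly_continuous_on V f}"

definition sup_norm :: "'a set \<Rightarrow> ('a \<Rightarrow> complex) \<Rightarrow> real" where
  "sup_norm V f = (SUP x\<in>V. cmod (f x))"

definition fun_scale :: "complex \<Rightarrow> ('a \<Rightarrow> complex) \<Rightarrow> 'a \<Rightarrow> complex" where
  "fun_scale c f = (\<lambda>x. c * f x)"

lemma vector_space_fun_scale: "vector_space fun_scale"
  by standard (simp_all add: fun_scale_def fun_eq_iff algebra_simps)


section \<open>The Daugavet property\<close>

text \<open>
  The spaces of interest depend on the set \<^term>\<open>V\<close> and hence are not types. A normed space is
  therefore given by a carrier \<^term>\<open>X\<close>, a subspace of an ambient complex vector space with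
  scalar multiplication \<^term>\<open>smul\<close>, and a function \<^term>\<open>nrm\<close> that is a norm on \<^term>\<open>X\<close>.
  Operators on \<^term>\<open>X\<close> are functions whose values outside \<^term>\<open>X\<close> are irrelevant.
\<close>

definition bounded_operator ::
  "(complex \<Rightarrow> 'b \<Rightarrow> 'b) \<Rightarrow> 'b::ab_group_add set \<Rightarrow> ('b \<Rightarrow> real) \<Rightarrow> ('b \<Rightarrow> 'b) \<Rightarrow> bool" where
  "bounded_operator smul X nrm T \<longleftrightarrow>
     (\<forall>x\<in>X. T x \<in> X) \<and>
     (\<forall>x\<in>X. \<forall>y\<in>X. T (x + y) = T x + T y) \<and>
     (\<forall>c. \<forall>x\<in>X. T (smul c x) = smul c (T x)) \<and>
     (\<exists>K. \<forall>x\<in>X. nrm (T x) \<le> K * nrm x)"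

definition operator_norm :: "'b set \<Rightarrow> ('b \<Rightarrow> real) \<Rightarrow> ('b \<Rightarrow> 'b) \<Rightarrow> real" where
  "operator_norm X nrm T = (SUP x\<in>{x\<in>X. nrm x \<le> 1}. nrm (T x))"

definition daugavet_property ::
  "(complex \<Rightarrow> 'b \<Rightarrow> 'b) \<Rightarrow> 'b::ab_group_add set \<Rightarrow> ('b \<Rightarrow> real) \<Rightarrow> bool" where
  "daugavet_property smul X nrm \<longleftrightarrow>
     (\<forall>T. bounded_operator smul X nrm T \<and> vector_space.dim smul (T ` X) = 1 \<longrightarrow>
        operator_norm X nrm (\<lambda>x. T x + x) = 1 + operator_norm X nrm T)"

end

theory Submission
  imports Defs "HOL-Complex_Analysis.Complex_Analysis"
begin

text \<open>
  Let \<open>T\<close> be a rank-one operator and let \<open>f\<close> in the unit ball be such that the norm of \<open>T f\<close> is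
  nearly that of \<open>T\<close>. The idea is to add to \<open>f\<close> a spike \<open>h\<close> at a point \<open>y\<close> where the absolute value
  of \<open>T f\<close> is almost the norm of \<open>T\<close>, such that \<open>f y + h y\<close> is nearly the phase of \<open>T f y\<close>, the norm
  of \<open>f + h\<close> is hardly more than \<open>1\<close>, and \<open>T h\<close> is small. Then the absolute value of
  \<open>T (f + h) + (f + h)\<close> at \<open>y\<close> is almost the norm of \<open>T\<close> plus one (\<open>spike_perturbation\<close>).

  The spikes come from the unit disc. A point of \<open>V\<close> lies on a complex line through \<open>0\<close> which meets
  the boundary of \<open>V\<close> in the unimodular multiples of some \<open>e\<close>, and there is a complex-linear
  functional \<open>l\<close> with \<open>l e = 1\<close> that maps \<open>V\<close> into the closed disc (\<open>complex_support_functional\<close>, an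
  application of the theorem of Hahn and Banach to the Minkowski functional). If \<open>u\<close> is
  differentiable at all points of the closed disc, then \<open>u \<circ> l\<close> belongs to the smallest of the
  three algebras, so one argument serves for all three. If \<open>u\<close> peaks at a boundary point and takes
  its values close to the interval from \<open>0\<close> to \<open>1\<close>, then replacing \<open>f\<close> by the nearly convex
  combination \<open>u \<omega> + (1 - u) f\<close> with \<open>\<bar>\<omega>\<bar> = 1\<close> hardly increases the norm (\<open>disc_peak_function\<close>).

  A functional can see a spike at one point, but not spikes at many points at once: if the peaks
  \<open>u\<^sub>1, \<dots>, u\<^sub>N\<close> are at different points and so sharp that the sum of their absolute values is at most
  \<open>2\<close>, then the absolute values of the functional on the \<open>N\<close> spikes have a sum that is bounded
  independently of \<open>N\<close>, and one of them is of order \<open>1 / N\<close> (\<open>sum_norm_functional_le\<close>). So many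
  boundary points are needed at which \<open>T f\<close> stays large. There are infinitely many of
  them on the boundary of the disc through \<open>e\<close>, because the maximum principle for bounded
  holomorphic functions tolerates finitely many exceptional points
  (\<open>infinite_boundary_cluster\<close>).
\<close>

section \<open>The Hahn-Banach theorem for sublinear functionals\<close>

definition sublinear :: "('a::real_vector \<Rightarrow> real) \<Rightarrow> bool" where
  "sublinear p \<longleftrightarrow> (\<forall>x y. p (x + y) \<le> p x + p y) \<and> (\<forall>c>0. \<forall>x. p (c *\<^sub>R x) \<le> c * p x)"

lemma sublinearI:
  assumes "\<And>x y. p (x + y) \<le> p x + p y" and "\<And>c x. c > 0 \<Longrightarrow> p (c *\<^sub>R x) \<le> c * p x"
  shows "sublinear p"
  using assms by (auto simp: sublinear_def)

lemma sublinear_add: "sublinear p \<Longrightarrow> p (x + y) \<le> p x + p y"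
  by (auto simp: sublinear_def)

lemma sublinear_scale_pos:
  assumes "sublinear p" "c > 0"
  shows "p (c *\<^sub>R x) = c * p x"
proof (rule antisym)
  show "p (c *\<^sub>R x) \<le> c * p x"
    using assms by (auto simp: sublinear_def)
  have "p (inverse c *\<^sub>R c *\<^sub>R x) \<le> inverse c * p (c *\<^sub>R x)"
    using assms unfolding sublinear_def by (metis inverse_positive_iff_positive)
  then show "c * p x \<le> p (c *\<^sub>R x)"
    using assms(2) by (simp add: field_simps)
qed

lemma sublinear_0:
  assumes "sublinear p"
  shows "p 0 = 0"
  using sublinear_scale_pos[OF assms, of 2 0] by simp

lemma sublinear_minus_ge: "sublinear p \<Longrightarrow> - p (- x) \<le> p x"
  using sublinear_add[of p x "- x"] sublinear_0[of p] by simp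

text \<open>
  Unless \<open>p (- y) = - p y\<close>, the infimum of \<open>p (x + t y) - t p y\<close> over \<open>t \<ge> 0\<close> is a strictly smaller
  sublinear functional. This serves twice: to see that minimal sublinear functionals are odd, and
  to force the value at a prescribed point.
\<close>

lemma sublinear_descent:
  assumes p: "sublinear p"
  obtains q where "sublinear q" "\<And>x. q x \<le> p x" "q (- y) \<le> - p y"
proof
  define S where "S x = (\<lambda>t. p (x + t *\<^sub>R y) - t * p y) ` {0..}" for x
  define q where "q x = Inf (S x)" for x
  have S_nonempty: "S x \<noteq> {}" for x
    by (auto simp: S_def)
  have S_bdd: "bdd_below (S x)" for x
  proof -
    have "- p (- x) \<le> p (x + t *\<^sub>R y) - t * p y" if "t \<ge> 0" for t
    proof -
      have "p (t *\<^sub>R y) = t * p y"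
        using that sublinear_scale_pos[OF p, of t y] sublinear_0[OF p] by (cases "t = 0") auto
      moreover have "p (t *\<^sub>R y) \<le> p (x + t *\<^sub>R y) + p (- x)"
        using sublinear_add[OF p, of "x + t *\<^sub>R y" "- x"] by simp
      ultimately show ?thesis by simp
    qed
    then show ?thesis by (auto simp: S_def intro!: bdd_belowI)
  qed
  have q_le: "q x \<le> p (x + t *\<^sub>R y) - t * p y" if "t \<ge> 0" for x t
    unfolding q_def using that by (intro cInf_lower S_bdd) (auto simp: S_def)
  have q_ge: "z \<le> q x" if "\<And>t. t \<ge> 0 \<Longrightarrow> z \<le> p (x + t *\<^sub>R y) - t * p y" for x z
    unfolding q_def using that by (intro cInf_greatest S_nonempty) (auto simp: S_def)
  show "sublinear q"
  proof (rule sublinearI)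
    fix x x'
    have "q (x + x') - (p (x' + t *\<^sub>R y) - t * p y) \<le> p (x + s *\<^sub>R y) - s * p y"
      if "s \<ge> 0" "t \<ge> 0" for s t
    proof -
      have "q (x + x') \<le> p ((x + s *\<^sub>R y) + (x' + t *\<^sub>R y)) - (s + t) * p y"
        using q_le[of "s + t" "x + x'"] that by (simp add: algebra_simps)
      with sublinear_add[OF p, of "x + s *\<^sub>R y" "x' + t *\<^sub>R y"] show ?thesis
        by (simp add: algebra_simps)
    qed
    then have "q (x + x') - (p (x' + t *\<^sub>R y) - t * p y) \<le> q x" if "t \<ge> 0" for t
      using that by (intro q_ge) auto
    then have "q (x + x') - q x \<le> q x'"
      by (intro q_ge) (simp add: algebra_simps)
    then show "q (x + x') \<le> q x + q x'" by simp
  next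
    fix c :: real and x assume c: "c > 0"
    have "q (c *\<^sub>R x) / c \<le> p (x + t *\<^sub>R y) - t * p y" if "t \<ge> 0" for t
    proof -
      have "q (c *\<^sub>R x) \<le> p (c *\<^sub>R (x + t *\<^sub>R y)) - (c * t) * p y"
        using q_le[of "c * t" "c *\<^sub>R x"] c that by (simp add: algebra_simps)
      also have "\<dots> = c * (p (x + t *\<^sub>R y) - t * p y)"
        using sublinear_scale_pos[OF p c, of "x + t *\<^sub>R y"] by (simp add: right_diff_distrib)
      finally show ?thesis using c by (simp add: field_simps)
    qed
    then have "q (c *\<^sub>R x) / c \<le> q x" by (rule q_ge)
    then show "q (c *\<^sub>R x) \<le> c * q x" using c by (simp add: field_simps)
  qed
  show "q x \<le> p x" for x using q_le[of 0 x] by simp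
  show "q (- y) \<le> - p y" using q_le[of 1 "- y"] sublinear_0[OF p] by simp
qed

text \<open>
  By Zorn's lemma: the pointwise infimum of a chain of sublinear functionals below \<open>p\<close> exists,
  since all of them are bounded below by \<open>- p (- x)\<close>, and it is subadditive because any two members
  of the chain have a smaller one among them.
\<close>

lemma minimal_sublinear_exists:
  assumes p: "sublinear p"
  obtains q where "sublinear q" "q \<le> p" "\<And>r. sublinear r \<Longrightarrow> r \<le> q \<Longrightarrow> r = q"
proof -
  define A where "A = {q. sublinear q \<and> q \<le> p}"
  have "\<exists>m\<in>A. \<forall>a\<in>A. a \<le> m \<longrightarrow> a = m"
  proof (rule predicate_Zorn)
    show "partial_order_on A (relation_of (\<lambda>x y. y \<le> x) A)"
      by (auto simp: partial_order_on_def preorder_on_def refl_on_def trans_def antisym_def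
          relation_of_def)
  next
    fix C assume "C \<in> Chains (relation_of (\<lambda>x y. y \<le> x) A)"
    then have chain: "C \<subseteq> A" "\<And>a b. a \<in> C \<Longrightarrow> b \<in> C \<Longrightarrow> a \<le> b \<or> b \<le> a"
      by (auto simp: Chains_def relation_of_def)
    show "\<exists>u\<in>A. \<forall>a\<in>C. u \<le> a"
    proof (cases "C = {}")
      case True
      then show ?thesis using p by (auto simp: A_def)
    next
      case False
      define u where "u x = (INF q\<in>C. q x)" for x
      have bdd: "bdd_below ((\<lambda>q. q x) ` C)" for x
      proof (rule bdd_belowI2)
        fix q assume "q \<in> C"
        then have "sublinear q" "q (- x) \<le> p (- x)"
          using chain(1) by (auto simp: A_def le_fun_def)
        then show "- p (- x) \<le> q x"
          using sublinear_minus_ge[of q x] by simp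
      qed
      have u_le: "u x \<le> q x" if "q \<in> C" for q x
        unfolding u_def by (intro cINF_lower bdd that)
      have u_ge: "z \<le> u x" if "\<And>q. q \<in> C \<Longrightarrow> z \<le> q x" for x z
        unfolding u_def by (intro cINF_greatest False that)
      have "sublinear u"
      proof (rule sublinearI)
        fix x y
        have "u (x + y) - r y \<le> q x" if "q \<in> C" "r \<in> C" for q r
        proof -
          have "q \<le> r \<or> r \<le> q" using chain(2) that by blast
          then obtain m where m: "m \<in> C" "m \<le> q" "m \<le> r"
            using \<open>q \<in> C\<close> \<open>r \<in> C\<close> order_refl by metis
          have "u (x + y) \<le> m x + m y"
            using u_le[OF m(1), of "x + y"] sublinear_add[of m x y] m(1) chain(1)
            by (force simp: A_def)
          also have "\<dots> \<le> q x + r y"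
            using m by (intro add_mono) (auto simp: le_fun_def)
          finally show ?thesis by simp
        qed
        then have "u (x + y) - r y \<le> u x" if "r \<in> C" for r
          using that by (intro u_ge) auto
        then have "u (x + y) - u x \<le> u y"
          by (intro u_ge) (simp add: algebra_simps)
        then show "u (x + y) \<le> u x + u y" by simp
      next
        fix c :: real and x assume c: "c > 0"
        have "u (c *\<^sub>R x) / c \<le> q x" if "q \<in> C" for q
        proof -
          have "u (c *\<^sub>R x) \<le> c * q x"
            using u_le[OF that, of "c *\<^sub>R x"] sublinear_scale_pos[of q c x] c that chain(1)
            by (force simp: A_def)
          then show ?thesis using c by (simp add: field_simps)
        qed
        then have "u (c *\<^sub>R x) / c \<le> u x" by (rule u_ge)
        then show "u (c *\<^sub>R x) \<le> c * u x" using c by (simp add: field_simps)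
      qed
      moreover have "u \<le> p"
      proof -
        obtain q where q: "q \<in> C" using False by auto
        then have "u \<le> q" using u_le by (simp add: le_fun_def)
        also have "q \<le> p" using q chain(1) by (auto simp: A_def)
        finally show ?thesis .
      qed
      ultimately show ?thesis using u_le by (auto simp: A_def le_fun_def)
    qed
  qed
  then show ?thesis using that by (auto simp: A_def)
qed

text \<open>
  A minimal sublinear functional is odd, hence both subadditive and superadditive, hence linear.
  Minimising not \<open>p\<close> itself but its descent in the direction \<open>z\<close> gives equality at \<open>z\<close>.
\<close>

lemma hahn_banach_sublinear:
  fixes p :: "'a::real_vector \<Rightarrow> real"
  assumes p: "sublinear p"
  obtains f where "linear f" "\<And>x. f x \<le> p x" "f z = p z"
proof -
  obtain p' where p': "sublinear p'" "\<And>x. p' x \<le> p x" "p' (- z) \<le> - p z"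
    using sublinear_descent[OF p] by blast
  obtain f where f: "sublinear f" "f \<le> p'" and
    minimal: "\<And>r. sublinear r \<Longrightarrow> r \<le> f \<Longrightarrow> r = f"
    using minimal_sublinear_exists[OF p'(1)] by blast
  have f_le: "f x \<le> p x" for x
    using f(2) p'(2)[of x] by (auto simp: le_fun_def intro: order_trans)
  have minus: "f (- y) = - f y" for y
  proof -
    obtain q where "sublinear q" "\<And>x. q x \<le> f x" "q (- y) \<le> - f y"
      using sublinear_descent[OF f(1)] by blast
    moreover from this have "q = f" by (intro minimal) (auto simp: le_fun_def)
    ultimately show ?thesis using sublinear_minus_ge[OF f(1), of "- y"] by auto
  qed
  have "linear f"
  proof (rule linearI)
    fix x y
    have "f (- x + - y) \<le> - f x - f y"
      using sublinear_add[OF f(1), of "- x" "- y"] by (simp add: minus)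
    then show "f (x + y) = f x + f y"
      using sublinear_add[OF f(1), of x y] minus[of "x + y"] by simp
  next
    fix c :: real and x
    show "f (c *\<^sub>R x) = c *\<^sub>R f x"
    proof (cases c "0 :: real" rule: linorder_cases)
      case less
      then show ?thesis
        using sublinear_scale_pos[OF f(1), of "- c" x] minus[of "c *\<^sub>R x"] by simp
    next
      case equal
      then show ?thesis by (simp add: sublinear_0[OF f(1)])
    next
      case greater
      then show ?thesis by (simp add: sublinear_scale_pos[OF f(1)])
    qed
  qed
  moreover have "f z = p z"
    using f_le[of z] le_funD[OF f(2), of "- z"] p'(3) minus[of z] by linarith
  ultimately show ?thesis using that f_le by blast
qed

section \<open>Support functionals of balanced convex sets\<close>

definition minkowski_functional :: "'a::real_vector set \<Rightarrow> 'a \<Rightarrow> real" where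
  "minkowski_functional V x = Inf {t. t > 0 \<and> inverse t *\<^sub>R x \<in> V}"

context
  fixes V :: "'a::real_normed_vector set"
  assumes V: "open V" "convex V" "0 \<in> V"
begin

lemma minkowski_dilates_nonempty: "{t. t > 0 \<and> inverse t *\<^sub>R x \<in> V} \<noteq> {}"
proof -
  obtain r where r: "r > 0" "ball 0 r \<subseteq> V"
    using V by (meson open_contains_ball)
  define t where "t = (norm x + 1) / r"
  have t: "t > 0" unfolding t_def using r by (intro divide_pos_pos) (auto intro: add_nonneg_pos)
  have "norm (inverse t *\<^sub>R x) = r * norm x / (norm x + 1)"
    using t r by (simp add: t_def)
  also have "\<dots> < r"
    using r by (simp add: divide_less_eq add_nonneg_pos)
  finally have "inverse t *\<^sub>R x \<in> V" using r(2) by (auto simp: subset_iff)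
  with t show ?thesis by auto
qed

lemma minkowski_functional_le:
  "t > 0 \<Longrightarrow> inverse t *\<^sub>R x \<in> V \<Longrightarrow> minkowski_functional V x \<le> t"
  unfolding minkowski_functional_def
  by (intro cInf_lower bdd_belowI[of _ 0]) auto

lemma minkowski_functional_ge:
  "(\<And>t. t > 0 \<Longrightarrow> inverse t *\<^sub>R x \<in> V \<Longrightarrow> z \<le> t) \<Longrightarrow> z \<le> minkowski_functional V x"
  unfolding minkowski_functional_def
  by (intro cInf_greatest minkowski_dilates_nonempty) auto

lemma minkowski_functional_less_imp_mem:
  assumes "minkowski_functional V x < 1"
  shows "x \<in> V"
proof -
  obtain t where t: "t > 0" "inverse t *\<^sub>R x \<in> V" "t < 1"
    using assms minkowski_functional_ge[of x 1] by (meson not_le)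
  have "t *\<^sub>R (inverse t *\<^sub>R x) + (1 - t) *\<^sub>R 0 \<in> V"
    using t V by (intro convexD) auto
  then show ?thesis using t by simp
qed

lemma sublinear_minkowski_functional: "sublinear (minkowski_functional V)"
proof (rule sublinearI)
  fix x y
  have "minkowski_functional V (x + y) - t \<le> s"
    if s: "s > 0" "inverse s *\<^sub>R x \<in> V" and t: "t > 0" "inverse t *\<^sub>R y \<in> V" for s t
  proof -
    have "(s / (s + t)) *\<^sub>R (inverse s *\<^sub>R x) + (t / (s + t)) *\<^sub>R (inverse t *\<^sub>R y) \<in> V"
      using s t V by (intro convexD) (auto simp flip: add_divide_distrib)
    also have "(s / (s + t)) *\<^sub>R (inverse s *\<^sub>R x) + (t / (s + t)) *\<^sub>R (inverse t *\<^sub>R y)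
        = inverse (s + t) *\<^sub>R (x + y)"
      using s t by (simp add: field_simps scaleR_add_right)
    finally show ?thesis using minkowski_functional_le[of "s + t" "x + y"] s t by auto
  qed
  then have "minkowski_functional V (x + y) - t \<le> minkowski_functional V x"
    if "t > 0" "inverse t *\<^sub>R y \<in> V" for t
    using that by (intro minkowski_functional_ge) auto
  then have "minkowski_functional V (x + y) - minkowski_functional V x \<le> minkowski_functional V y"
    by (intro minkowski_functional_ge) (simp add: algebra_simps)
  then show "minkowski_functional V (x + y) \<le> minkowski_functional V x + minkowski_functional V y"
    by simp
next
  fix c :: real and x assume c: "c > 0"
  have "minkowski_functional V (c *\<^sub>R x) / c \<le> t" if "t > 0" "inverse t *\<^sub>R x \<in> V" for t
    using minkowski_functional_le[of "c * t" "c *\<^sub>R x"] c that by (simp add: field_simps)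
  then have "minkowski_functional V (c *\<^sub>R x) / c \<le> minkowski_functional V x"
    by (rule minkowski_functional_ge)
  then show "minkowski_functional V (c *\<^sub>R x) \<le> c * minkowski_functional V x"
    using c by (simp add: field_simps)
qed

lemma minkowski_functional_pos:
  assumes "bounded V" "x \<noteq> 0"
  shows "minkowski_functional V x > 0"
proof -
  obtain R where R: "R > 0" "\<And>x. x \<in> V \<Longrightarrow> norm x \<le> R"
    using assms(1) bounded_pos by blast
  have "norm x / R \<le> t" if "t > 0" "inverse t *\<^sub>R x \<in> V" for t
    using R(2)[OF that(2)] R(1) that(1) by (simp add: field_simps)
  then have "norm x / R \<le> minkowski_functional V x" by (rule minkowski_functional_ge)
  moreover have "norm x / R > 0" using R assms(2) by simp
  ultimately show ?thesis by linarith
qed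

end

text \<open>
  The vector \<open>e\<close> is the multiple of \<open>v\<close> whose Minkowski functional is \<open>1\<close>. The functional \<open>l\<close> is the
  complexification of a real-linear functional that is dominated by the Minkowski functional and
  agrees with it at \<open>e\<close>.
\<close>

lemma complex_support_functional:
  fixes V :: "'a::complex_banach set"
  assumes V: "open V" "convex V" "0 \<in> V" "balanced V" "bounded V" and v: "v \<noteq> 0"
  obtains e k l where "v = k *\<^sub>C e" "\<And>c. cmod c < 1 \<Longrightarrow> c *\<^sub>C e \<in> V"
    "bounded_linear l" "\<And>c x. l (c *\<^sub>C x) = c * l x" "\<And>x. x \<in> V \<Longrightarrow> cmod (l x) \<le> 1" "l e = 1"
proof -
  define p where "p = minkowski_functional V"
  define e where "e = inverse (p v) *\<^sub>R v"
  have sub: "sublinear p" unfolding p_def using V by (intro sublinear_minkowski_functional)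
  have pv: "p v > 0" unfolding p_def using V v by (intro minkowski_functional_pos)
  have pe: "p e = 1"
    using sublinear_scale_pos[OF sub, of "inverse (p v)" v] pv by (simp add: e_def)
  obtain f where f: "linear f" "\<And>x. f x \<le> p x" "f e = p e"
    using hahn_banach_sublinear[OF sub] by blast
  have f_le: "f x \<le> 1" if "x \<in> V" for x
    using f(2)[of x] minkowski_functional_le[of V 1 x] V that by (simp add: p_def)
  define l where "l x = Complex (f x) (- f (\<i> *\<^sub>C x))" for x
  have l_add: "l (x + y) = l x + l y" for x y
    using f(1) by (simp add: l_def complex_eq_iff scaleC_add_right linear_add)
  have l_i: "l (\<i> *\<^sub>C x) = \<i> * l x" for x
  proof -
    have "\<i> *\<^sub>C \<i> *\<^sub>C x = - x"
      using scaleR_scaleC[of "-1" x] by (simp add: scaleC_scaleC)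
    then show ?thesis using f(1) by (simp add: l_def complex_eq_iff linear_neg)
  qed
  have l_R: "l (r *\<^sub>R x) = of_real r * l x" for r x
  proof -
    have "\<i> *\<^sub>C r *\<^sub>R x = r *\<^sub>R \<i> *\<^sub>C x" by (simp add: scaleR_scaleC scaleC_scaleC mult.commute)
    then show ?thesis using f(1) by (simp add: l_def complex_eq_iff linear_scale)
  qed
  have l_C: "l (c *\<^sub>C x) = c * l x" for c x
  proof -
    have "c *\<^sub>C x = (of_real (Re c) + of_real (Im c) * \<i>) *\<^sub>C x"
      by (rule arg_cong[where f = "\<lambda>c. c *\<^sub>C x"]) (simp add: complex_eq_iff)
    also have "\<dots> = Re c *\<^sub>R x + Im c *\<^sub>R \<i> *\<^sub>C x"
      by (simp add: scaleR_scaleC scaleC_scaleC scaleC_add_left)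
    finally have "l (c *\<^sub>C x) = (of_real (Re c) + \<i> * of_real (Im c)) * l x"
      by (simp add: l_add l_R l_i algebra_simps)
    then show ?thesis by (simp flip: complex_eq)
  qed
  \<comment> \<open>Rotating \<^term>\<open>x\<close> inside the balanced set makes \<^term>\<open>l x\<close> real, where the bound on
    the real part applies.\<close>
  have l_le: "cmod (l x) \<le> 1" if x: "x \<in> V" for x
  proof (cases "l x = 0")
    case False
    define c where "c = cnj (l x) / cmod (l x)"
    have c: "cmod c = 1" using False by (simp add: c_def norm_divide)
    have "l (c *\<^sub>C x) = (l x * cnj (l x)) / cmod (l x)"
      by (simp add: l_C c_def)
    also have "\<dots> = of_real (cmod (l x))"
      using False by (simp add: power2_eq_square flip: complex_norm_square)
    finally have "l (c *\<^sub>C x) = of_real (cmod (l x))" .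
    then have "f (c *\<^sub>C x) = cmod (l x)" by (simp add: l_def complex_eq_iff)
    moreover have "c *\<^sub>C x \<in> V" using V(4) x c by (auto simp: balanced_def)
    ultimately show ?thesis using f_le by metis
  qed auto
  have l_bounded: "bounded_linear l"
  proof -
    obtain r where r: "r > 0" "cball 0 r \<subseteq> V"
      using V by (meson open_contains_cball)
    have "norm (l x) \<le> norm x * inverse r" for x
    proof (cases "x = 0")
      case True
      then show ?thesis using l_R[of 0 0] by simp
    next
      case False
      have "(r / norm x) *\<^sub>R x \<in> V" using r False by auto
      then have "cmod (l ((r / norm x) *\<^sub>R x)) \<le> 1" by (rule l_le)
      then show ?thesis using r False by (simp add: l_R norm_mult norm_divide field_simps)
    qed
    then show ?thesis
      using l_add l_R by (intro bounded_linear_intro[of _ "inverse r"]) (auto simp: scaleR_conv_of_real)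
  qed
  have mem: "c *\<^sub>C e \<in> V" if c: "cmod c < 1" for c
  proof -
    define s where "s = (1 + cmod c) / 2"
    have s: "0 < s" "s < 1" "cmod c < s"
      using c norm_ge_zero[of c] by (auto simp: s_def simp del: norm_ge_zero)
    have "p (s *\<^sub>R e) < 1" using sublinear_scale_pos[OF sub s(1)] pe s by simp
    then have "s *\<^sub>R e \<in> V" unfolding p_def by (rule minkowski_functional_less_imp_mem[OF V(1-3)])
    moreover have "cmod (c / s) \<le> 1" using s by (simp add: norm_divide)
    ultimately have "(c / s) *\<^sub>C s *\<^sub>R e \<in> V" using V(4) by (auto simp: balanced_def)
    then show ?thesis using s by (simp add: scaleR_scaleC scaleC_scaleC)
  qed
  have "l e = 1"
  proof -
    have "cmod (l e) \<le> 1"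
    proof (rule field_le_mult_one_interval)
      fix s :: real assume s: "0 < s" "s < 1"
      then have "of_real s *\<^sub>C e \<in> V" by (intro mem) simp
      then have "cmod (of_real s * l e) \<le> 1" using l_le l_C by metis
      then show "s * cmod (l e) \<le> 1" using s by (simp add: norm_mult)
    qed
    moreover have re: "Re (l e) = 1" using f(3) pe by (simp add: l_def)
    ultimately have "Im (l e) = 0" by (simp add: cmod_def)
    with re show ?thesis by (simp add: complex_eq_iff)
  qed
  moreover have "v = of_real (p v) *\<^sub>C e"
    using pv by (simp add: e_def flip: scaleR_scaleC)
  ultimately show ?thesis using that mem l_bounded l_C l_le by blast
qed

section \<open>Boundary behaviour of bounded holomorphic functions on the disc\<close>

text \<open>
  By compactness of the unit circle the bound holds on all circles of radius close to \<open>1\<close>.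
\<close>

lemma maximum_modulus_unit_disc_boundary:
  assumes hol: "F holomorphic_on ball 0 1"
    and bdry: "\<And>\<mu>. cmod \<mu> = 1 \<Longrightarrow> \<exists>\<eta>>0. \<forall>z\<in>ball 0 1 \<inter> ball \<mu> \<eta>. cmod (F z) \<le> c"
    and z0: "z0 \<in> ball 0 1"
  shows "cmod (F z0) \<le> c"
proof -
  obtain \<eta> where \<eta>: "\<And>\<mu>. cmod \<mu> = 1 \<Longrightarrow> \<eta> \<mu> > 0"
    "\<And>\<mu> z. cmod \<mu> = 1 \<Longrightarrow> z \<in> ball 0 1 \<inter> ball \<mu> (\<eta> \<mu>) \<Longrightarrow> cmod (F z) \<le> c"
    using bdry by metis
  define U where "U = (\<Union>\<mu>\<in>sphere 0 1. ball \<mu> (\<eta> \<mu>))"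
  define C where "C = insert z0 (cball 0 1 - U)"
  have "compact C"
    unfolding C_def U_def by (intro compact_insert compact_diff open_UN) auto
  moreover have "C \<noteq> {}" by (auto simp: C_def)
  ultimately obtain w where w: "w \<in> C" "\<And>z. z \<in> C \<Longrightarrow> cmod z \<le> cmod w"
    using continuous_attains_sup[of C cmod] continuous_on_norm_id by blast
  have "\<mu> \<in> U" if "cmod \<mu> = 1" for \<mu>
    unfolding U_def using that \<eta>(1)[OF that] by (intro UN_I[of \<mu>]) auto
  then have w1: "cmod w < 1"
    using w(1) z0 by (force simp: C_def)
  define r where "r = (1 + cmod w) / 2"
  have r: "cmod w < r" "r < 1" using w1 by (auto simp: r_def)
  show ?thesis
  proof (rule maximum_modulus_frontier[of F "cball 0 r"])
    show "F holomorphic_on interior (cball 0 r)" "continuous_on (closure (cball 0 r)) F"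
      using r hol by (auto intro!: holomorphic_on_imp_continuous_on intro: holomorphic_on_subset)
    show "z0 \<in> cball 0 r" using w(2)[of z0] r by (simp add: C_def)
    fix z :: complex assume "z \<in> frontier (cball 0 r)"
    then have z: "cmod z = r"
      using order.strict_trans1[OF norm_ge_zero r(1)] by (simp add: frontier_cball)
    then have "z \<in> U" using r w(2)[of z] by (force simp: C_def)
    then show "cmod (F z) \<le> c" using z r \<eta>(2) by (auto simp: U_def)
  qed auto
qed

text \<open>
  A maximum principle with exceptional points: if all cluster values of \<open>G\<close> outside \<open>K\<close> were
  at most \<open>a\<close>, then this bound would hold inside the disc. Multiplying \<open>G ^ m\<close> by one polynomial
  \<open>P\<close> that vanishes on \<open>K\<close> removes the exceptional points, and taking \<open>m\<close>-th roots for
  \<open>m \<rightarrow> \<infinity>\<close> removes the effect of \<open>P\<close>.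
\<close>

lemma boundary_cluster_off_finite_set:
  assumes hol: "G holomorphic_on ball 0 1"
    and bound: "\<And>z. z \<in> ball 0 1 \<Longrightarrow> cmod (G z) \<le> B"
    and K: "finite K"
    and z0: "z0 \<in> ball 0 1" "a < cmod (G z0)" and a: "a > 0"
  shows "\<exists>\<mu>. cmod \<mu> = 1 \<and> \<mu> \<notin> K \<and> (\<forall>\<eta>>0. \<exists>z\<in>ball 0 1 \<inter> ball \<mu> \<eta>. a < cmod (G z))"
proof (rule ccontr)
  assume "\<not> ?thesis"
  then have small: "\<exists>\<eta>>0. \<forall>z\<in>ball 0 1 \<inter> ball \<mu> \<eta>. cmod (G z) \<le> a" if "cmod \<mu> = 1" "\<mu> \<notin> K" for \<mu>
    using that by (meson not_le)
  define P where "P z = (\<Prod>\<mu>\<in>K \<inter> sphere 0 1. (\<mu> - z) / 2)" for z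
  have P_le: "cmod (P z) \<le> 1" if "cmod z \<le> 1" for z
  proof -
    have "cmod ((\<mu> - z) / 2) \<le> 1" if "cmod \<mu> = 1" for \<mu>
      using norm_triangle_ineq4[of \<mu> z] \<open>cmod z \<le> 1\<close> that by (simp add: norm_divide)
    then show ?thesis
      unfolding P_def prod_norm[symmetric] by (intro prod_le_1) auto
  qed
  have P_nz: "P z0 \<noteq> 0"
    using z0 K by (auto simp: P_def)
  have P_cont: "continuous_on UNIV P"
    unfolding P_def by (intro continuous_intros) auto
  have B: "B > 0" using bound[OF z0(1)] z0 a by linarith
  \<comment> \<open>Near an exceptional point \<^term>\<open>G\<close> is only bounded by \<^term>\<open>B\<close>, but there the zero of
    \<^term>\<open>P\<close> makes the product small.\<close>
  have bd: "cmod (G z0 ^ m * P z0) \<le> a ^ m" for m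
  proof (rule maximum_modulus_unit_disc_boundary[OF _ _ z0(1)])
    show "(\<lambda>z. G z ^ m * P z) holomorphic_on ball 0 1"
      unfolding P_def by (intro holomorphic_intros hol) auto
    fix \<mu> :: complex assume \<mu>: "cmod \<mu> = 1"
    show "\<exists>\<eta>>0. \<forall>z\<in>ball 0 1 \<inter> ball \<mu> \<eta>. cmod (G z ^ m * P z) \<le> a ^ m"
    proof (cases "\<mu> \<in> K")
      case False
      then obtain \<eta> where \<eta>: "\<eta> > 0" "\<And>z. z \<in> ball 0 1 \<inter> ball \<mu> \<eta> \<Longrightarrow> cmod (G z) \<le> a"
        using small \<mu> by blast
      have "cmod (G z ^ m * P z) \<le> a ^ m * 1" if "z \<in> ball 0 1 \<inter> ball \<mu> \<eta>" for z
        unfolding norm_mult norm_power using that \<eta>(2)[OF that] P_le[of z] a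
        by (intro mult_mono power_mono) auto
      then show ?thesis using \<eta>(1) by auto
    next
      case True
      then have "P \<mu> = 0" using \<mu> K by (auto simp: P_def)
      moreover have "(a / B) ^ m > 0" using a B by simp
      ultimately obtain \<eta> where \<eta>: "\<eta> > 0" "\<And>z. dist z \<mu> < \<eta> \<Longrightarrow> cmod (P z) < (a / B) ^ m"
        using P_cont unfolding continuous_on_iff by (metis UNIV_I dist_0_norm dist_commute)
      have "cmod (G z ^ m * P z) \<le> B ^ m * (a / B) ^ m" if "z \<in> ball 0 1 \<inter> ball \<mu> \<eta>" for z
        unfolding norm_mult norm_power using that \<eta>(2)[of z] bound[of z] B
        by (intro mult_mono power_mono) (auto simp: dist_commute)
      also have "B ^ m * (a / B) ^ m = a ^ m" using B by (simp add: power_divide)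
      finally show ?thesis using \<eta>(1) by blast
    qed
  qed
  \<comment> \<open>The bound says that the powers of \<^term>\<open>cmod (G z0) / a\<close> are at most
    \<^term>\<open>1 / cmod (P z0)\<close>, although they are unbounded.\<close>
  have "cmod (G z0) / a > 1" using z0 a by simp
  then obtain m where m: "1 / cmod (P z0) < (cmod (G z0) / a) ^ m"
    using real_arch_pow by blast
  then have "a ^ m < cmod (G z0) ^ m * cmod (P z0)"
    using P_nz a by (simp add: power_divide field_simps)
  with bd[of m] show False by (simp add: norm_mult norm_power)
qed

lemma infinite_boundary_cluster:
  assumes "G holomorphic_on ball 0 1" "\<And>z. z \<in> ball 0 1 \<Longrightarrow> cmod (G z) \<le> B"
    "z0 \<in> ball 0 1" "a < cmod (G z0)" "a > 0"
  shows "infinite {\<mu>. cmod \<mu> = 1 \<and> (\<forall>\<eta>>0. \<exists>z\<in>ball 0 1 \<inter> ball \<mu> \<eta>. a < cmod (G z))}"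
proof
  assume "finite {\<mu>. cmod \<mu> = 1 \<and> (\<forall>\<eta>>0. \<exists>z\<in>ball 0 1 \<inter> ball \<mu> \<eta>. a < cmod (G z))}"
  from boundary_cluster_off_finite_set[OF assms(1,2) this assms(3,4,5)] show False by blast
qed

section \<open>Peak functions on the disc\<close>

text \<open>
  The function \<open>z \<mapsto> 1 / (1 + s (1 - z cnj \<mu>))\<close> maps the closed disc into the disc with diameter from
  \<open>0\<close> to \<open>1\<close>, takes the value \<open>1\<close> at \<open>\<mu>\<close> and is small away from \<open>\<mu>\<close> for large \<open>s\<close>. Its power with a
  small exponent \<open>\<delta>\<close> has all its values in a thin sector around the interval from \<open>0\<close> to \<open>1\<close>,
  which is what the third property expresses; the smallness away from \<open>\<mu>\<close> is recovered by
  choosing \<open>s\<close> after \<open>\<delta>\<close>.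
\<close>

lemma disc_peak_function:
  assumes \<mu>: "cmod \<mu> = 1" and d: "d > 0" and \<kappa>: "\<kappa> > 0" and \<epsilon>: "\<epsilon> > 0"
  obtains u where "u \<mu> = 1" "\<And>z. cmod z \<le> 1 \<Longrightarrow> u field_differentiable at z"
    "\<And>z. cmod z \<le> 1 \<Longrightarrow> cmod (u z) + cmod (1 - u z) \<le> 1 + \<epsilon>"
    "\<And>z. cmod z \<le> 1 \<Longrightarrow> cmod (u z) \<le> 1"
    "\<And>z. cmod z \<le> 1 \<Longrightarrow> d \<le> dist z \<mu> \<Longrightarrow> cmod (u z) \<le> \<kappa>"
proof -
  define \<delta> where "\<delta> = \<epsilon> / 2"
  have \<delta>: "\<delta> > 0" using \<epsilon> by (simp add: \<delta>_def)
  \<comment> \<open>Chosen so that \<^term>\<open>(s * d) powr (- \<delta>) = \<kappa>\<close>.\<close>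
  define s where "s = exp (- ln \<kappa> / \<delta>) / d"
  have s: "s > 0" using d by (simp add: s_def)
  define w where "w z = 1 + of_real s * (1 - z * cnj \<mu>)" for z
  define u where "u z = exp (- of_real \<delta> * Ln (w z))" for z
  have Re_w: "Re (w z) \<ge> 1" if z: "cmod z \<le> 1" for z
  proof -
    have "Re (z * cnj \<mu>) \<le> cmod (z * cnj \<mu>)" by (rule complex_Re_le_cmod)
    also have "\<dots> \<le> 1" using z \<mu> by (simp add: norm_mult)
    finally have "0 \<le> s * (1 - Re (z * cnj \<mu>))" using s by simp
    then show ?thesis by (simp add: w_def)
  qed
  have w_nz: "w z \<noteq> 0" if "cmod z \<le> 1" for z
    using Re_w[OF that] by auto
  have w_ge: "cmod (w z) \<ge> 1" if "cmod z \<le> 1" for z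
    using Re_w[OF that] complex_Re_le_cmod[of "w z"] by linarith
  have norm_u: "cmod (u z) = exp (- \<delta> * ln (cmod (w z)))" if "cmod z \<le> 1" for z
    using w_nz[OF that] by (simp add: u_def)
  have u_le: "cmod (u z) \<le> 1" if "cmod z \<le> 1" for z
    using w_ge[OF that] \<delta> unfolding norm_u[OF that] by simp
  have "\<mu> * cnj \<mu> = 1" using \<mu> by (simp flip: complex_norm_square)
  then have "u \<mu> = 1" by (simp add: u_def w_def)
  moreover have "u field_differentiable at z" if z: "cmod z \<le> 1" for z
  proof -
    have "w z \<notin> \<real>\<^sub>\<le>\<^sub>0" using Re_w[OF z] by (auto simp: complex_nonpos_Reals_iff)
    then have "(u has_field_derivative u z * (- of_real \<delta> * (inverse (w z) * (- of_real s * cnj \<mu>)))) (at z)"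
      unfolding u_def w_def by (auto intro!: derivative_eq_intros simp: field_simps)
    then show ?thesis by (auto simp: field_differentiable_def)
  qed
  moreover have "cmod (u z) + cmod (1 - u z) \<le> 1 + \<epsilon>" if z: "cmod z \<le> 1" for z
  proof -
    define \<rho> where "\<rho> = cmod (u z)"
    define \<alpha> where "\<alpha> = - \<delta> * Im (Ln (w z))"
    have u: "u z = of_real \<rho> * exp (\<i> * of_real \<alpha>)"
    proof -
      have "- of_real \<delta> * Ln (w z) = of_real (- \<delta> * Re (Ln (w z))) + \<i> * of_real \<alpha>"
        by (simp add: complex_eq_iff \<alpha>_def)
      then have "u z = of_real (exp (- \<delta> * Re (Ln (w z)))) * exp (\<i> * of_real \<alpha>)"
        unfolding u_def by (simp only: exp_add exp_of_real)
      moreover have "\<rho> = exp (- \<delta> * Re (Ln (w z)))"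
        by (simp add: \<rho>_def u_def norm_exp_eq_Re del: Re_Ln)
      ultimately show ?thesis by simp
    qed
    have \<rho>: "0 \<le> \<rho>" "\<rho> \<le> 1" using u_le[OF z] by (auto simp: \<rho>_def)
    have "\<bar>Im (Ln (w z))\<bar> < pi / 2" using Re_w[OF z] by (intro Re_Ln_pos_lt_imp) linarith
    then have "\<bar>Im (Ln (w z))\<bar> \<le> 2" using pi_less_4 by linarith
    then have "\<delta> * \<bar>Im (Ln (w z))\<bar> \<le> \<delta> * 2" using \<delta> by (intro mult_left_mono) auto
    then have \<alpha>: "\<bar>\<alpha>\<bar> \<le> \<epsilon>" using \<delta> by (simp add: \<alpha>_def abs_mult \<delta>_def)
    \<comment> \<open>Go from \<^term>\<open>u z\<close> to \<^term>\<open>1\<close> along the circle to its modulus and then along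
      the real axis.\<close>
    have "1 - u z = of_real (1 - \<rho>) + of_real \<rho> * (1 - exp (\<i> * of_real \<alpha>))"
      by (simp add: u algebra_simps)
    also have "cmod \<dots> \<le> (1 - \<rho>) + \<rho> * cmod (1 - exp (\<i> * of_real \<alpha>))"
      by (rule order_trans[OF norm_triangle_ineq]) (use \<rho> in \<open>auto simp: norm_mult simp del: of_real_diff\<close>)
    also have "\<rho> * cmod (1 - exp (\<i> * of_real \<alpha>)) \<le> 1 * \<bar>\<alpha>\<bar>"
    proof (rule mult_mono)
      show "cmod (1 - exp (\<i> * of_real \<alpha>)) \<le> \<bar>\<alpha>\<bar>"
        using dist_exp_i_1[of \<alpha>] abs_sin_le_one abs_sin_x_le_abs_x[of "\<alpha> / 2"]
        by (simp add: norm_minus_commute)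
    qed (use \<rho> in auto)
    finally show ?thesis using \<alpha> by (simp add: \<rho>_def)
  qed
  moreover have "cmod (u z) \<le> \<kappa>" if z: "cmod z \<le> 1" and far: "d \<le> dist z \<mu>" for z
  proof -
    have "1 - z * cnj \<mu> = (\<mu> - z) * cnj \<mu>"
      using \<open>\<mu> * cnj \<mu> = 1\<close> by (simp add: algebra_simps)
    then have "cmod (1 - z * cnj \<mu>) = dist z \<mu>"
      using \<mu> by (simp add: norm_mult dist_norm norm_minus_commute)
    then have "s * d \<le> cmod (w z - 1)" using far s by (simp add: w_def norm_mult)
    also have "cmod (w z - 1) \<le> cmod (w z)"
    proof (rule power2_le_imp_le)
      show "(cmod (w z - 1))\<^sup>2 \<le> (cmod (w z))\<^sup>2"
        using Re_w[OF z] unfolding cmod_power2 by (simp add: power2_eq_square algebra_simps)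
    qed simp
    finally have "exp (- ln \<kappa> / \<delta>) \<le> cmod (w z)" using d by (simp add: s_def)
    then have "- ln \<kappa> / \<delta> \<le> ln (cmod (w z))"
      using w_nz[OF z] by (subst ln_ge_iff) auto
    then have "- \<delta> * ln (cmod (w z)) \<le> ln \<kappa>" using \<delta> by (simp add: field_simps)
    then have "cmod (u z) \<le> exp (ln \<kappa>)" unfolding norm_u[OF z] by simp
    then show ?thesis using \<kappa> by simp
  qed
  ultimately show ?thesis using that u_le by blast
qed

text \<open>
  Neighbourhoods of the points of \<open>K\<close> in which the peaks are not small can be taken to be disjoint.
  A point lies in at most one of them, where the peak contributes at most \<open>1\<close>, and all other
  peaks together contribute at most \<open>1\<close>.
\<close>

lemma disc_peak_family:
  assumes K: "finite K" "\<And>\<mu>. \<mu> \<in> K \<Longrightarrow> cmod \<mu> = 1" and \<epsilon>: "\<epsilon> > 0"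
  obtains u where "\<And>\<mu>. \<mu> \<in> K \<Longrightarrow> u \<mu> \<mu> = 1"
    "\<And>\<mu> z. \<mu> \<in> K \<Longrightarrow> cmod z \<le> 1 \<Longrightarrow> u \<mu> field_differentiable at z"
    "\<And>\<mu> z. \<mu> \<in> K \<Longrightarrow> cmod z \<le> 1 \<Longrightarrow> cmod (u \<mu> z) + cmod (1 - u \<mu> z) \<le> 1 + \<epsilon>"
    "\<And>z. cmod z \<le> 1 \<Longrightarrow> (\<Sum>\<mu>\<in>K. cmod (u \<mu> z)) \<le> 2"
proof -
  obtain d where d: "d > 0" "\<And>\<mu> \<nu>. \<mu> \<in> K \<Longrightarrow> \<nu> \<in> K \<Longrightarrow> \<mu> \<noteq> \<nu> \<Longrightarrow> d \<le> dist \<mu> \<nu>"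
    using uniform_discrete_finite_iff[of K] K(1) unfolding uniform_discrete_def by (metis not_le)
  define \<kappa> where "\<kappa> = 1 / (1 + real (card K))"
  have \<kappa>: "\<kappa> > 0" by (simp add: \<kappa>_def)
  have "\<exists>u. u \<mu> = 1 \<and> (\<forall>z. cmod z \<le> 1 \<longrightarrow> u field_differentiable at z
      \<and> cmod (u z) + cmod (1 - u z) \<le> 1 + \<epsilon> \<and> cmod (u z) \<le> 1
      \<and> (d / 2 \<le> dist z \<mu> \<longrightarrow> cmod (u z) \<le> \<kappa>))" if "\<mu> \<in> K" for \<mu>
    using disc_peak_function[of \<mu> "d / 2" \<kappa> \<epsilon>] K(2)[OF that] d(1) \<kappa> \<epsilon> by (smt (verit) half_gt_zero)
  then obtain u where u: "\<And>\<mu>. \<mu> \<in> K \<Longrightarrow> u \<mu> \<mu> = 1"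
    "\<And>\<mu> z. \<mu> \<in> K \<Longrightarrow> cmod z \<le> 1 \<Longrightarrow> u \<mu> field_differentiable at z
      \<and> cmod (u \<mu> z) + cmod (1 - u \<mu> z) \<le> 1 + \<epsilon> \<and> cmod (u \<mu> z) \<le> 1
      \<and> (d / 2 \<le> dist z \<mu> \<longrightarrow> cmod (u \<mu> z) \<le> \<kappa>)"
    by metis
  have "(\<Sum>\<mu>\<in>K. cmod (u \<mu> z)) \<le> 2" if z: "cmod z \<le> 1" for z
  proof -
    define near where "near = {\<mu>\<in>K. dist z \<mu> < d / 2}"
    have "\<mu> = \<nu>" if "\<mu> \<in> near" "\<nu> \<in> near" for \<mu> \<nu>
      using d(2)[of \<mu> \<nu>] dist_triangle3[of \<mu> \<nu> z] that by (force simp: near_def)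
    then have near1: "card near \<le> 1"
      using K(1) by (auto simp: near_def card_le_Suc0_iff_eq)
    have "(\<Sum>\<mu>\<in>K. cmod (u \<mu> z)) = (\<Sum>\<mu>\<in>near. cmod (u \<mu> z)) + (\<Sum>\<mu>\<in>K - near. cmod (u \<mu> z))"
      using K(1) by (subst sum.subset_diff[of near]) (auto simp: near_def)
    also have "\<dots> \<le> real (card near) * 1 + real (card (K - near)) * \<kappa>"
      using u(2)[OF _ z] by (intro add_mono sum_bounded_above) (auto simp: near_def)
    also have "\<dots> \<le> 1 * 1 + real (card K) * \<kappa>"
      using near1 \<kappa> K(1) by (intro add_mono mult_right_mono) (auto intro: card_mono)
    also have "real (card K) * \<kappa> \<le> 1" by (simp add: \<kappa>_def field_simps)
    finally show ?thesis by simp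
  qed
  then show ?thesis using that u by blast
qed

section \<open>The three algebras of bounded holomorphic functions\<close>

lemma bounded_on_bound:
  assumes "bounded (f ` V)"
  obtains B where "B > 0" "\<And>x. x \<in> V \<Longrightarrow> norm (f x) \<le> B"
  using assms unfolding bounded_pos by blast

lemma H_inf_add:
  assumes "f \<in> H_inf V" "g \<in> H_inf V"
  shows "(\<lambda>x. f x + g x) \<in> H_inf V"
proof -
  have "holomorphic (\<lambda>x. f x + g x) V"
    unfolding holomorphic_def
  proof
    fix x assume "x \<in> V"
    then obtain D E where D: "(f has_derivative D) (at x within V)" "\<And>c h. D (c *\<^sub>C h) = c * D h"
      and E: "(g has_derivative E) (at x within V)" "\<And>c h. E (c *\<^sub>C h) = c * E h"
      using assms by (auto simp: H_inf_def holomorphic_def) metis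
    have "((\<lambda>x. f x + g x) has_derivative (\<lambda>h. D h + E h)) (at x within V)"
      by (intro has_derivative_add D E)
    moreover have "D (c *\<^sub>C h) + E (c *\<^sub>C h) = c * (D h + E h)" for c h
      by (simp add: D E distrib_left)
    ultimately show "\<exists>D. ((\<lambda>x. f x + g x) has_derivative D) (at x within V)
        \<and> (\<forall>c h. D (c *\<^sub>C h) = c * D h)"
      by blast
  qed
  moreover have "bounded ((\<lambda>x. f x + g x) ` V)"
    using assms by (intro bounded_plus_comp) (auto simp: H_inf_def)
  ultimately show ?thesis using assms by (auto simp: H_inf_def)
qed

lemma H_inf_mult:
  assumes "f \<in> H_inf V" "g \<in> H_inf V"
  shows "(\<lambda>x. f x * g x) \<in> H_inf V"
proof -
  have "holomorphic (\<lambda>x. f x * g x) V"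
    unfolding holomorphic_def
  proof
    fix x assume "x \<in> V"
    then obtain D E where D: "(f has_derivative D) (at x within V)" "\<And>c h. D (c *\<^sub>C h) = c * D h"
      and E: "(g has_derivative E) (at x within V)" "\<And>c h. E (c *\<^sub>C h) = c * E h"
      using assms by (auto simp: H_inf_def holomorphic_def) metis
    have "((\<lambda>x. f x * g x) has_derivative (\<lambda>h. f x * E h + D h * g x)) (at x within V)"
      by (intro has_derivative_mult D E)
    moreover have "f x * E (c *\<^sub>C h) + D (c *\<^sub>C h) * g x = c * (f x * E h + D h * g x)" for c h
      by (simp add: D E algebra_simps)
    ultimately show "\<exists>D. ((\<lambda>x. f x * g x) has_derivative D) (at x within V)
        \<and> (\<forall>c h. D (c *\<^sub>C h) = c * D h)"
      by blast
  qed
  moreover have "bounded ((\<lambda>x. f x * g x) ` V)"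
  proof -
    obtain A where A: "A > 0" "\<And>x. x \<in> V \<Longrightarrow> norm (f x) \<le> A"
      using assms(1) bounded_on_bound[of f V] unfolding H_inf_def by blast
    obtain B where B: "B > 0" "\<And>x. x \<in> V \<Longrightarrow> norm (g x) \<le> B"
      using assms(2) bounded_on_bound[of g V] unfolding H_inf_def by blast
    have "norm (f x * g x) \<le> A * B" if "x \<in> V" for x
      unfolding norm_mult using A B that by (intro mult_mono) auto
    then show ?thesis by (auto simp: bounded_iff)
  qed
  ultimately show ?thesis using assms by (auto simp: H_inf_def)
qed

lemma uniformly_continuous_on_mult_bounded:
  fixes f g :: "'a::metric_space \<Rightarrow> complex"
  assumes f: "uniformly_continuous_on V f" "bounded (f ` V)"
    and g: "uniformly_continuous_on V g" "bounded (g ` V)"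
  shows "uniformly_continuous_on V (\<lambda>x. f x * g x)"
proof -
  obtain A where A: "A > 0" "\<And>x. x \<in> V \<Longrightarrow> norm (f x) \<le> A"
    using bounded_on_bound[OF f(2)] by blast
  obtain B where B: "B > 0" "\<And>x. x \<in> V \<Longrightarrow> norm (g x) \<le> B"
    using bounded_on_bound[OF g(2)] by blast
  show ?thesis
    unfolding uniformly_continuous_on_def
  proof (intro allI impI)
    fix e :: real assume e: "e > 0"
    obtain d1 where d1: "d1 > 0"
      "\<And>x y. x \<in> V \<Longrightarrow> y \<in> V \<Longrightarrow> dist y x < d1 \<Longrightarrow> dist (f y) (f x) < e / (2 * B)"
      using f(1) e B(1) unfolding uniformly_continuous_on_def
      by (metis divide_pos_pos mult_pos_pos zero_less_numeral)
    obtain d2 where d2: "d2 > 0"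
      "\<And>x y. x \<in> V \<Longrightarrow> y \<in> V \<Longrightarrow> dist y x < d2 \<Longrightarrow> dist (g y) (g x) < e / (2 * A)"
      using g(1) e A(1) unfolding uniformly_continuous_on_def
      by (metis divide_pos_pos mult_pos_pos zero_less_numeral)
    have "dist (f y * g y) (f x * g x) < e" if "x \<in> V" "y \<in> V" "dist y x < min d1 d2" for x y
    proof -
      have "f y * g y - f x * g x = (f y - f x) * g y + f x * (g y - g x)"
        by (simp add: algebra_simps)
      then have "dist (f y * g y) (f x * g x)
          \<le> norm (f y - f x) * norm (g y) + norm (f x) * norm (g y - g x)"
        unfolding dist_norm by (metis norm_triangle_ineq norm_mult)
      also have "\<dots> \<le> norm (f y - f x) * B + A * norm (g y - g x)"
        using A B that by (intro add_mono mult_mono) auto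
      also have "\<dots> < e / (2 * B) * B + A * (e / (2 * A))"
        using d1(2)[of x y] d2(2)[of x y] A(1) B(1) that
        by (intro add_strict_mono mult_strict_right_mono mult_strict_left_mono)
          (auto simp: dist_norm)
      also have "\<dots> = e" using A(1) B(1) by (simp add: field_simps)
      finally show ?thesis .
    qed
    then show "\<exists>d>0. \<forall>x\<in>V. \<forall>x'\<in>V. dist x' x < d \<longrightarrow> dist (f x' * g x') (f x * g x) < e"
      using d1(1) d2(1) by (intro exI[of _ "min d1 d2"]) auto
  qed
qed

lemma sup_norm_le: "V \<noteq> {} \<Longrightarrow> (\<And>x. x \<in> V \<Longrightarrow> cmod (f x) \<le> c) \<Longrightarrow> sup_norm V f \<le> c"
  unfolding sup_norm_def by (intro cSUP_least)

context
  fixes V :: "'a::complex_banach set" and \<A> :: "('a \<Rightarrow> complex) set"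
  assumes \<A>: "\<A> \<in> {A_u V, A_inf V, H_inf V}"
begin

lemma algebra_subset_H_inf: "\<A> \<subseteq> H_inf V"
  using \<A> by (auto simp: A_u_def A_inf_def)

lemma A_u_subset_algebra: "A_u V \<subseteq> \<A>"
proof -
  have "A_u V \<subseteq> A_inf V"
    unfolding A_u_def A_inf_def
    by clarify (metis uniformly_continuous_imp_continuous uniformly_continuous_on_extension_on_closure)
  then show ?thesis using \<A> by (auto simp: A_u_def)
qed

lemma algebra_add:
  assumes "f \<in> \<A>" "g \<in> \<A>"
  shows "(\<lambda>x. f x + g x) \<in> \<A>"
proof -
  have "(\<lambda>x. f x + g x) \<in> H_inf V"
    using assms algebra_subset_H_inf by (intro H_inf_add) auto
  moreover have "uniformly_continuous_on V (\<lambda>x. f x + g x)" if "f \<in> A_u V" "g \<in> A_u V"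
    using that by (intro uniformly_continuous_on_add) (auto simp: A_u_def)
  moreover have "\<exists>h. continuous_on (closure V) h \<and> (\<forall>x\<in>V. h x = f x + g x)"
    if fg: "f \<in> A_inf V" "g \<in> A_inf V"
  proof -
    obtain f' g' where "continuous_on (closure V) f'" "\<forall>x\<in>V. f' x = f x"
      "continuous_on (closure V) g'" "\<forall>x\<in>V. g' x = g x"
      using fg unfolding A_inf_def by blast
    then show ?thesis by (intro exI[of _ "\<lambda>x. f' x + g' x"]) (auto intro: continuous_on_add)
  qed
  ultimately show ?thesis using \<A> assms by (auto simp: A_u_def A_inf_def)
qed

lemma algebra_mult:
  assumes "f \<in> \<A>" "g \<in> \<A>"
  shows "(\<lambda>x. f x * g x) \<in> \<A>"
proof -
  have "(\<lambda>x. f x * g x) \<in> H_inf V"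
    using assms algebra_subset_H_inf by (intro H_inf_mult) auto
  moreover have "uniformly_continuous_on V (\<lambda>x. f x * g x)" if "f \<in> A_u V" "g \<in> A_u V"
    using that by (intro uniformly_continuous_on_mult_bounded) (auto simp: A_u_def H_inf_def)
  moreover have "\<exists>h. continuous_on (closure V) h \<and> (\<forall>x\<in>V. h x = f x * g x)"
    if fg: "f \<in> A_inf V" "g \<in> A_inf V"
  proof -
    obtain f' g' where "continuous_on (closure V) f'" "\<forall>x\<in>V. f' x = f x"
      "continuous_on (closure V) g'" "\<forall>x\<in>V. g' x = g x"
      using fg unfolding A_inf_def by blast
    then show ?thesis by (intro exI[of _ "\<lambda>x. f' x * g' x"]) (auto intro: continuous_on_mult)
  qed
  ultimately show ?thesis using \<A> assms by (auto simp: A_u_def A_inf_def)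
qed

text \<open>
  This makes the algebras rich. Uniform continuity comes for free: \<open>l\<close> is Lipschitz and \<open>u\<close> is
  continuous on the compact disc.
\<close>

lemma disc_function_of_functional_mem:
  assumes l: "bounded_linear l" "\<And>c x. l (c *\<^sub>C x) = c * l x"
    and l_le: "\<And>x. x \<in> V \<Longrightarrow> cmod (l x) \<le> 1"
    and u: "\<And>z. cmod z \<le> 1 \<Longrightarrow> u field_differentiable at z"
  shows "(\<lambda>x. if x \<in> V then u (l x) else 0) \<in> \<A>"
proof -
  define k where "k x = (if x \<in> V then u (l x) else 0)" for x
  have u_unif: "uniformly_continuous_on (cball 0 1) u"
    using u by (intro compact_uniformly_continuous compact_cball continuous_at_imp_continuous_on)
      (auto intro: field_differentiable_imp_continuous_at)
  have "holomorphic k V"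
    unfolding holomorphic_def
  proof
    fix x assume x: "x \<in> V"
    obtain u' where "(u has_field_derivative u') (at (l x))"
      using u[OF l_le[OF x]] by (auto simp: field_differentiable_def)
    then have "((\<lambda>x. u (l x)) has_derivative (\<lambda>h. u' * l h)) (at x within V)"
      using has_derivative_compose[OF bounded_linear_imp_has_derivative[OF l(1)]]
      by (auto simp: has_field_derivative_def)
    then have "(k has_derivative (\<lambda>h. u' * l h)) (at x within V)"
      by (rule has_derivative_transform[OF x, rotated]) (auto simp: k_def)
    then show "\<exists>D. (k has_derivative D) (at x within V) \<and> (\<forall>c h. D (c *\<^sub>C h) = c * D h)"
      by (intro exI[of _ "\<lambda>h. u' * l h"]) (auto simp: l(2))
  qed
  moreover have "bounded (k ` V)"
  proof (rule bounded_subset)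
    show "bounded (u ` cball 0 1)"
      using u_unif by (intro compact_imp_bounded compact_continuous_image
          uniformly_continuous_imp_continuous) auto
    show "k ` V \<subseteq> u ` cball 0 1" using l_le by (auto simp: k_def)
  qed
  moreover have "uniformly_continuous_on V k"
  proof -
    have "uniformly_continuous_on V l"
      using bounded_linear.uniformly_continuous_on[OF l(1), of V "\<lambda>x. x"]
      by (simp add: uniformly_continuous_on_id)
    moreover have "l ` V \<subseteq> cball 0 1" using l_le by auto
    then have "uniformly_continuous_on (l ` V) u"
      using u_unif unfolding uniformly_continuous_on_def by (metis subsetD)
    ultimately have "uniformly_continuous_on V (\<lambda>x. u (l x))"
      by (rule uniformly_continuous_on_compose[of V l u])
    then show ?thesis by (simp add: k_def uniformly_continuous_on_def)
  qed
  ultimately have "k \<in> A_u V" by (auto simp: A_u_def H_inf_def k_def)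
  then show ?thesis using A_u_subset_algebra unfolding k_def by blast
qed

lemma constant_mem: "(\<lambda>x. if x \<in> V then c else 0) \<in> \<A>"
  using disc_function_of_functional_mem[of "\<lambda>_. 0" "\<lambda>_. c"] by simp

lemma algebra_scale:
  assumes "f \<in> \<A>"
  shows "(\<lambda>x. c * f x) \<in> \<A>"
proof -
  have "(\<lambda>x. (if x \<in> V then c else 0) * f x) = (\<lambda>x. c * f x)"
    using assms algebra_subset_H_inf by (auto simp: H_inf_def fun_eq_iff)
  then show ?thesis using algebra_mult[OF constant_mem assms, of c] by simp
qed

lemma algebra_sum:
  assumes "finite K" "\<And>i. i \<in> K \<Longrightarrow> h i \<in> \<A>"
  shows "(\<lambda>x. \<Sum>i\<in>K. h i x) \<in> \<A>"
  using assms
proof (induction K rule: finite_induct)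
  case empty
  then show ?case using constant_mem[of 0] by (simp cong: if_cong)
next
  case (insert i K)
  then show ?case using algebra_add[of "h i" "\<lambda>x. \<Sum>i\<in>K. h i x"] by simp
qed

lemma norm_le_sup_norm:
  assumes "f \<in> \<A>" "x \<in> V"
  shows "cmod (f x) \<le> sup_norm V f"
  unfolding sup_norm_def
proof (intro cSUP_upper assms(2))
  have "bounded (f ` V)" using assms algebra_subset_H_inf by (auto simp: H_inf_def)
  then show "bdd_above ((\<lambda>x. cmod (f x)) ` V)"
    by (auto simp: bounded_iff bdd_above_def)
qed

lemma disc_slice_holomorphic:
  assumes V: "open V" and f: "f \<in> \<A>" and e: "\<And>c. cmod c < 1 \<Longrightarrow> c *\<^sub>C e \<in> V"
  shows "(\<lambda>c. f (c *\<^sub>C e)) holomorphic_on ball 0 1"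
  unfolding holomorphic_on_def
proof
  have line: "bounded_linear (\<lambda>c. c *\<^sub>C e)"
    by (rule bounded_linear_intro[of _ "norm e"])
      (auto simp: scaleC_add_left scaleC_scaleC scaleR_scaleC norm_scaleC scaleC_complex_def)
  fix c :: complex assume "c \<in> ball 0 1"
  then have ce: "c *\<^sub>C e \<in> V" by (intro e) auto
  then obtain D where D: "(f has_derivative D) (at (c *\<^sub>C e))" "\<And>c h. D (c *\<^sub>C h) = c * D h"
    using f algebra_subset_H_inf at_within_open[OF ce V] unfolding H_inf_def holomorphic_def
    by fastforce
  have "((\<lambda>c. f (c *\<^sub>C e)) has_derivative (\<lambda>h. D (h *\<^sub>C e))) (at c)"
    using has_derivative_compose[OF bounded_linear_imp_has_derivative[OF line] D(1)] .
  moreover have "(\<lambda>h. D (h *\<^sub>C e)) = (*) (D e)"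
    by (simp add: D(2) fun_eq_iff mult.commute)
  ultimately have "((\<lambda>c. f (c *\<^sub>C e)) has_field_derivative D e) (at c)"
    by (simp only: has_field_derivative_def)
  then show "(\<lambda>c. f (c *\<^sub>C e)) field_differentiable at c within ball 0 1"
    using field_differentiable_at_within field_differentiable_def by blast
qed

text \<open>
  Rotating each \<open>h i\<close> so that the value of the functional becomes nonnegative turns the left-hand
  side into a single value, at a function whose supremum norm is at most \<open>B\<close>.
\<close>

lemma sum_norm_functional_le:
  assumes \<psi>_add: "\<And>f g. f \<in> \<A> \<Longrightarrow> g \<in> \<A> \<Longrightarrow> \<psi> (\<lambda>x. f x + g x) = \<psi> f + \<psi> g"
    and \<psi>_scale: "\<And>c f. f \<in> \<A> \<Longrightarrow> \<psi> (\<lambda>x. c * f x) = c * \<psi> f"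
    and \<psi>_bound: "\<And>f. f \<in> \<A> \<Longrightarrow> cmod (\<psi> f) \<le> C * sup_norm V f" and "C \<ge> 0"
    and K: "finite K" "\<And>i. i \<in> K \<Longrightarrow> h i \<in> \<A>"
    and "V \<noteq> {}" and B: "\<And>x. x \<in> V \<Longrightarrow> (\<Sum>i\<in>K. cmod (h i x)) \<le> B"
  shows "(\<Sum>i\<in>K. cmod (\<psi> (h i))) \<le> C * B"
proof -
  define s where "s i = cnj (sgn (\<psi> (h i)))" for i
  have s_le: "cmod (s i) \<le> 1" for i by (simp add: s_def norm_sgn)
  have s: "s i * \<psi> (h i) = of_real (cmod (\<psi> (h i)))" for i
    by (cases "\<psi> (h i) = 0")
      (simp_all add: s_def sgn_eq mult.commute power2_eq_square flip: complex_norm_square)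
  have \<psi>_sum: "\<psi> (\<lambda>x. \<Sum>i\<in>J. s i * h i x) = (\<Sum>i\<in>J. s i * \<psi> (h i))" if "J \<subseteq> K" for J
    using finite_subset[OF that K(1)] that
  proof (induction J rule: finite_induct)
    case empty
    have "\<psi> (\<lambda>x. 0 * 0) = 0 * \<psi> (\<lambda>x. 0)"
      using constant_mem[of 0] by (intro \<psi>_scale) (simp cong: if_cong)
    then show ?case by simp
  next
    case (insert i J)
    then have "\<psi> (\<lambda>x. s i * h i x + (\<Sum>j\<in>J. s j * h j x))
        = \<psi> (\<lambda>x. s i * h i x) + \<psi> (\<lambda>x. \<Sum>j\<in>J. s j * h j x)"
      using K by (intro \<psi>_add algebra_sum algebra_scale) auto
    with insert K show ?case by (simp add: \<psi>_scale)
  qed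
  have "(\<Sum>i\<in>K. cmod (\<psi> (h i))) = cmod (of_real (\<Sum>i\<in>K. cmod (\<psi> (h i))))"
    by (simp add: sum_nonneg del: of_real_sum)
  also have "\<dots> = cmod (\<psi> (\<lambda>x. \<Sum>i\<in>K. s i * h i x))"
    by (simp add: \<psi>_sum s)
  also have "\<dots> \<le> C * sup_norm V (\<lambda>x. \<Sum>i\<in>K. s i * h i x)"
    using K by (intro \<psi>_bound algebra_sum algebra_scale) auto
  also have "\<dots> \<le> C * B"
  proof (intro mult_left_mono sup_norm_le)
    fix x assume x: "x \<in> V"
    have "cmod (\<Sum>i\<in>K. s i * h i x) \<le> (\<Sum>i\<in>K. cmod (h i x))"
      using s_le by (intro sum_norm_le) (auto simp: norm_mult intro: mult_left_le_one_le)
    then show "cmod (\<Sum>i\<in>K. s i * h i x) \<le> B" using B[OF x] by linarith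
  qed fact+
  finally show ?thesis .
qed

end

section \<open>Spikes that a functional does not see\<close>

text \<open>
  The perturbed function is \<open>u \<omega> + (1 - u) f\<close>, where \<open>u\<close> is one of \<open>N\<close> peak functions composed with
  the support functional, \<open>\<omega>\<close> is the phase of \<open>F\<close> at the point \<open>y\<close> near the peak, and \<open>N\<close> is so
  large that one of the spikes has a small value under \<open>\<psi>\<close>.
\<close>

lemma spike_perturbation:
  fixes V :: "'a::complex_banach set"
  assumes nontrivial: "(UNIV :: 'a set) \<noteq> {0}"
    and V: "bounded V" "open V" "balanced V" "convex V" "0 \<in> V"
    and \<A>: "\<A> \<in> {A_u V, A_inf V, H_inf V}"
    and \<psi>_add: "\<And>f g. f \<in> \<A> \<Longrightarrow> g \<in> \<A> \<Longrightarrow> \<psi> (\<lambda>x. f x + g x) = \<psi> f + \<psi> g"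
    and \<psi>_scale: "\<And>c f. f \<in> \<A> \<Longrightarrow> \<psi> (\<lambda>x. c * f x) = c * \<psi> f"
    and \<psi>_bound: "\<And>f. f \<in> \<A> \<Longrightarrow> cmod (\<psi> f) \<le> C * sup_norm V f" and C: "C \<ge> 0"
    and f: "f \<in> \<A>" "\<And>x. x \<in> V \<Longrightarrow> cmod (f x) \<le> 1"
    and F: "F \<in> \<A>" "x0 \<in> V" "a < cmod (F x0)" "a > 0"
    and \<epsilon>: "\<epsilon> > 0"
  obtains h y where "h \<in> \<A>" "y \<in> V" "\<And>x. x \<in> V \<Longrightarrow> cmod (f x + h x) \<le> 1 + \<epsilon>"
    "cmod (\<psi> h) \<le> \<epsilon>" "a + 1 - \<epsilon> \<le> cmod (F y + (f y + h y))"
proof -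
  \<comment> \<open>The point \<^term>\<open>x0\<close> may be \<open>0\<close>; then any complex line through it will do.\<close>
  obtain v k0 where v: "v \<noteq> (0 :: 'a)" "x0 = k0 *\<^sub>C v"
  proof (cases "x0 = 0")
    case True
    obtain v :: 'a where "v \<noteq> 0" using nontrivial by auto
    moreover have "x0 = 0 *\<^sub>C v" using True scaleR_scaleC[of 0 v] by simp
    ultimately show ?thesis using that by blast
  next
    case False
    moreover have "x0 = 1 *\<^sub>C x0" using scaleR_scaleC[of 1 x0] by simp
    ultimately show ?thesis using that by blast
  qed
  obtain e k1 l where "v = k1 *\<^sub>C e" and e: "\<And>c. cmod c < 1 \<Longrightarrow> c *\<^sub>C e \<in> V"
    and l: "bounded_linear l" "\<And>c x. l (c *\<^sub>C x) = c * l x" "\<And>x. x \<in> V \<Longrightarrow> cmod (l x) \<le> 1" "l e = 1"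
    using complex_support_functional[OF V(2,4,5,3,1) v(1)] by metis
  then obtain k where k: "x0 = k *\<^sub>C e" using v(2) by (auto simp: scaleC_scaleC)
  \<comment> \<open>The functional only gives \<^term>\<open>cmod k \<le> 1\<close>; the inequality is strict because a slightly
    larger multiple of \<^term>\<open>x0\<close> is still in the open set \<^term>\<open>V\<close>.\<close>
  have "cmod k < 1"
  proof -
    have "((\<lambda>t. t *\<^sub>R x0) \<longlongrightarrow> 1 *\<^sub>R x0) (at_right 1)" by (intro tendsto_intros)
    then have "eventually (\<lambda>t. t *\<^sub>R x0 \<in> V) (at_right 1)"
      using V(2) F(2) by (auto dest: topological_tendstoD)
    then have "eventually (\<lambda>t. 1 < t \<and> t *\<^sub>R x0 \<in> V) (at_right (1 :: real))"
      by (intro eventually_conj eventually_at_right_less)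
    then obtain t where t: "t > 1" "t *\<^sub>R x0 \<in> V"
      using eventually_happens'[OF trivial_limit_at_right_real] by blast
    have "t * cmod k \<le> 1"
      using l(3)[OF t(2)] l(4) t(1) by (simp add: scaleR_scaleC l(2) k norm_mult)
    then show ?thesis using t(1) mult_left_mono[of 1 "cmod k" t] by linarith
  qed
  define G where "G c = F (c *\<^sub>C e)" for c
  define M where "M = {\<mu>. cmod \<mu> = 1 \<and> (\<forall>\<eta>>0. \<exists>z\<in>ball 0 1 \<inter> ball \<mu> \<eta>. a < cmod (G z))}"
  have "infinite M"
    unfolding M_def
  proof (rule infinite_boundary_cluster)
    show "G holomorphic_on ball 0 1"
      unfolding G_def using disc_slice_holomorphic[OF \<A> V(2) F(1) e] .
    show "cmod (G z) \<le> sup_norm V F" if "z \<in> ball 0 1" for z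
      unfolding G_def using that by (intro norm_le_sup_norm[OF \<A> F(1)] e) auto
    show "k \<in> ball 0 1" "a < cmod (G k)" "a > 0"
      using F \<open>cmod k < 1\<close> k by (auto simp: G_def)
  qed
  \<comment> \<open>The \<open>4\<close> bounds the sum of the spikes: the peaks add up to at most \<open>2\<close>, and each
    is multiplied by a difference of two functions bounded by \<open>1\<close>.\<close>
  define N where "N = nat \<lceil>4 * C / \<epsilon>\<rceil> + 1"
  have N: "N > 0" "4 * C \<le> \<epsilon> * real N"
  proof -
    have "4 * C / \<epsilon> \<le> real N" unfolding N_def by linarith
    then show "4 * C \<le> \<epsilon> * real N" using \<epsilon> by (simp add: field_simps)
  qed (simp add: N_def)
  obtain K where K: "K \<subseteq> M" "finite K" "card K = N"
    using infinite_arbitrarily_large[OF \<open>infinite M\<close>] by blast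
  have K1: "cmod \<mu> = 1" if "\<mu> \<in> K" for \<mu> using that K(1) by (auto simp: M_def)
  obtain u where u: "\<And>\<mu>. \<mu> \<in> K \<Longrightarrow> u \<mu> \<mu> = 1"
    "\<And>\<mu> z. \<mu> \<in> K \<Longrightarrow> cmod z \<le> 1 \<Longrightarrow> u \<mu> field_differentiable at z"
    "\<And>\<mu> z. \<mu> \<in> K \<Longrightarrow> cmod z \<le> 1 \<Longrightarrow> cmod (u \<mu> z) + cmod (1 - u \<mu> z) \<le> 1 + \<epsilon>"
    "\<And>z. cmod z \<le> 1 \<Longrightarrow> (\<Sum>\<mu>\<in>K. cmod (u \<mu> z)) \<le> 2"
    using disc_peak_family[OF K(2) K1 \<epsilon>] by metis
  have "\<exists>z. cmod z < 1 \<and> a < cmod (G z) \<and> cmod (1 - u \<mu> z) < \<epsilon> / 2" if \<mu>: "\<mu> \<in> K" for \<mu>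
  proof -
    have "isCont (u \<mu>) \<mu>"
      using u(2)[OF \<mu>, of \<mu>] K1[OF \<mu>] by (intro field_differentiable_imp_continuous_at) auto
    then obtain \<eta> where \<eta>: "\<eta> > 0" "\<And>z. dist z \<mu> < \<eta> \<Longrightarrow> dist (u \<mu> z) (u \<mu> \<mu>) < \<epsilon> / 2"
      using \<epsilon> unfolding continuous_at_eps_delta by (metis half_gt_zero)
    obtain z where z: "z \<in> ball 0 1 \<inter> ball \<mu> \<eta>" "a < cmod (G z)"
      using \<mu> K(1) \<eta>(1) unfolding M_def by blast
    then have "dist (u \<mu> z) 1 < \<epsilon> / 2" using \<eta>(2)[of z] u(1)[OF \<mu>] by (simp add: dist_commute)
    with z show ?thesis by (auto simp: dist_norm norm_minus_commute)
  qed
  then obtain z where z: "\<And>\<mu>. \<mu> \<in> K \<Longrightarrow> cmod (z \<mu>) < 1" "\<And>\<mu>. \<mu> \<in> K \<Longrightarrow> a < cmod (G (z \<mu>))"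
    "\<And>\<mu>. \<mu> \<in> K \<Longrightarrow> cmod (1 - u \<mu> (z \<mu>)) < \<epsilon> / 2"
    by metis
  define \<omega> where "\<omega> \<mu> = sgn (G (z \<mu>))" for \<mu>
  have \<omega>: "cmod (\<omega> \<mu>) \<le> 1" for \<mu> by (simp add: \<omega>_def norm_sgn)
  \<comment> \<open>On \<^term>\<open>V\<close> this is \<open>u (\<omega> - f)\<close>; the definition by cases exhibits it as an element
    of the algebra.\<close>
  define h where "h \<mu> x = (if x \<in> V then u \<mu> (l x) else 0) * ((if x \<in> V then \<omega> \<mu> else 0) + (- 1) * f x)"
    for \<mu> x
  have h_mem: "h \<mu> \<in> \<A>" if "\<mu> \<in> K" for \<mu>
    unfolding h_def using u(2)[OF that] l
    by (intro algebra_mult[OF \<A>] algebra_add[OF \<A>] algebra_scale[OF \<A>] constant_mem[OF \<A>]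
        disc_function_of_functional_mem[OF \<A>] f(1)) auto
  have h_eq: "h \<mu> x = u \<mu> (l x) * (\<omega> \<mu> - f x)" if "x \<in> V" for \<mu> x
    using that by (simp add: h_def)
  have diff_le: "cmod (\<omega> \<mu> - f x) \<le> 2" if "x \<in> V" for \<mu> x
    using norm_triangle_ineq4[of "\<omega> \<mu>" "f x"] \<omega>[of \<mu>] f(2)[OF that] by linarith
  have "(\<Sum>\<mu>\<in>K. cmod (h \<mu> x)) \<le> 4" if x: "x \<in> V" for x
  proof -
    have "(\<Sum>\<mu>\<in>K. cmod (h \<mu> x)) \<le> (\<Sum>\<mu>\<in>K. cmod (u \<mu> (l x)) * 2)"
      unfolding h_eq[OF x] norm_mult using diff_le[OF x] by (intro sum_mono mult_left_mono) auto
    also have "\<dots> \<le> 2 * 2"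
      unfolding sum_distrib_right[symmetric] using u(4)[OF l(3)[OF x]] by (intro mult_right_mono) auto
    finally show ?thesis by simp
  qed
  then have sum_\<psi>: "(\<Sum>\<mu>\<in>K. cmod (\<psi> (h \<mu>))) \<le> C * 4"
    using V(5) h_mem
    by (intro sum_norm_functional_le[OF \<A> \<psi>_add \<psi>_scale \<psi>_bound C K(2)]) auto
  have "\<exists>\<mu>\<in>K. cmod (\<psi> (h \<mu>)) \<le> \<epsilon>"
  proof (rule ccontr)
    assume "\<not> ?thesis"
    then have "(\<Sum>\<mu>\<in>K. \<epsilon>) < (\<Sum>\<mu>\<in>K. cmod (\<psi> (h \<mu>)))"
      using K N by (intro sum_strict_mono) auto
    then show False using sum_\<psi> N K(3) by (simp add: mult.commute)
  qed
  then obtain \<mu> where \<mu>: "\<mu> \<in> K" "cmod (\<psi> (h \<mu>)) \<le> \<epsilon>" by blast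
  define y where "y = z \<mu> *\<^sub>C e"
  have y: "y \<in> V" "l y = z \<mu>" using e z(1)[OF \<mu>(1)] l by (auto simp: y_def)
  show ?thesis
  proof (rule that[of "h \<mu>" y])
    show "cmod (f x + h \<mu> x) \<le> 1 + \<epsilon>" if x: "x \<in> V" for x
    proof -
      have "f x + h \<mu> x = u \<mu> (l x) * \<omega> \<mu> + (1 - u \<mu> (l x)) * f x"
        by (simp add: h_eq[OF x] algebra_simps)
      also have "cmod \<dots> \<le> cmod (u \<mu> (l x)) * 1 + cmod (1 - u \<mu> (l x)) * 1"
        using \<omega> f(2)[OF x] by (intro norm_triangle_le) (auto simp: norm_mult intro!: add_mono mult_left_le)
      also have "\<dots> \<le> 1 + \<epsilon>" using u(3)[OF \<mu>(1) l(3)[OF x]] by simp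
      finally show ?thesis .
    qed
    have Fy: "F y = of_real (cmod (F y)) * \<omega> \<mu>" "a < cmod (F y)"
      using z(2)[OF \<mu>(1)] by (auto simp: y_def G_def \<omega>_def sgn_eq)
    have "cmod (\<omega> \<mu>) = 1" using Fy(2) F(4) by (auto simp: \<omega>_def norm_sgn y_def G_def)
    have "cmod ((1 - u \<mu> (l y)) * (\<omega> \<mu> - f y)) \<le> (\<epsilon> / 2) * 2"
      unfolding norm_mult using z(3)[OF \<mu>(1)] diff_le[OF y(1)] y(2) \<epsilon> by (intro mult_mono) auto
    moreover have "F y + (f y + h \<mu> y)
        = of_real (cmod (F y) + 1) * \<omega> \<mu> - (1 - u \<mu> (l y)) * (\<omega> \<mu> - f y)"
      by (subst Fy(1)) (simp add: h_eq[OF y(1)] algebra_simps)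
    moreover have "cmod (of_real (cmod (F y) + 1) * \<omega> \<mu>) = cmod (F y) + 1"
      using \<open>cmod (\<omega> \<mu>) = 1\<close> by (simp add: norm_mult del: of_real_add)
    ultimately show "a + 1 - \<epsilon> \<le> cmod (F y + (f y + h \<mu> y))"
      using Fy(2) norm_triangle_ineq2[of "of_real (cmod (F y) + 1) * \<omega> \<mu>" "(1 - u \<mu> (l y)) * (\<omega> \<mu> - f y)"]
      by simp
  qed (use \<mu> y h_mem in auto)
qed

section \<open>The Daugavet property\<close>

lemma one_dimensional_range:
  assumes "vector_space.dim fun_scale (T ` X) = 1"
  obtains g where "g \<in> T ` X" "g \<noteq> 0" "\<And>f. f \<in> X \<Longrightarrow> \<exists>k. T f = fun_scale k g"
proof -
  interpret vector_space fun_scale by (rule vector_space_fun_scale)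
  obtain B where B: "B \<subseteq> T ` X" "independent B" "T ` X \<subseteq> span B" "card B = dim (T ` X)"
    using basis_exists by blast
  then obtain g where g: "B = {g}" using assms by (auto simp: card_1_singleton_iff)
  show ?thesis
  proof
    show "g \<in> T ` X" "g \<noteq> 0" using B g by auto
    show "\<exists>k. T f = fun_scale k g" if "f \<in> X" for f
      using that B(3) by (auto simp: g span_singleton)
  qed
qed

theorem corollary2p3:
  fixes V :: "'a::complex_banach set" and \<A> :: "('a \<Rightarrow> complex) set"
  assumes "(UNIV :: 'a set) \<noteq> {0}"
    and "bounded V" and "open V" and "balanced V" and "convex V" and "0 \<in> V"
    and "\<A> \<in> {A_u V, A_inf V, H_inf V}"
  shows "daugavet_property fun_scale \<A> (sup_norm V)"
  unfolding daugavet_property_def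
proof (intro allI impI, elim conjE)
  fix T :: "('a \<Rightarrow> complex) \<Rightarrow> 'a \<Rightarrow> complex"
  assume T: "bounded_operator fun_scale \<A> (sup_norm V) T"
    and rank: "vector_space.dim fun_scale (T ` \<A>) = 1"
  note \<A> = assms(7)
  have ne: "V \<noteq> {}" using assms by auto
  have T_mem: "T f \<in> \<A>" if "f \<in> \<A>" for f
    using T that by (auto simp: bounded_operator_def)
  have T_add: "T (\<lambda>x. f x + g x) = (\<lambda>x. T f x + T g x)" if "f \<in> \<A>" "g \<in> \<A>" for f g
    using T that by (auto simp: bounded_operator_def plus_fun_def)
  have T_scale: "T (\<lambda>x. c * f x) = (\<lambda>x. c * T f x)" if "f \<in> \<A>" for f c
    using T that by (auto simp: bounded_operator_def fun_scale_def)
  have pos: "0 \<le> sup_norm V f" if "f \<in> \<A>" for f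
    using norm_le_sup_norm[OF \<A> that assms(6)] norm_ge_zero order_trans by blast
  obtain C where C: "C \<ge> 0" "\<And>f. f \<in> \<A> \<Longrightarrow> sup_norm V (T f) \<le> C * sup_norm V f"
  proof -
    obtain C where C: "\<And>f. f \<in> \<A> \<Longrightarrow> sup_norm V (T f) \<le> C * sup_norm V f"
      using T unfolding bounded_operator_def by blast
    have "sup_norm V (T f) \<le> \<bar>C\<bar> * sup_norm V f" if "f \<in> \<A>" for f
      using C[OF that] mult_right_mono[OF abs_ge_self pos[OF that], of C] by linarith
    then show thesis using that[of "\<bar>C\<bar>"] by auto
  qed
  define S where "S = {f \<in> \<A>. sup_norm V f \<le> 1}"
  define M where "M = operator_norm \<A> (sup_norm V) T"
  have zero_mem: "(\<lambda>_. 0) \<in> S"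
    using constant_mem[OF \<A>, of 0] sup_norm_le[OF ne, of "\<lambda>_. 0" 1] by (simp add: S_def cong: if_cong)
  have M_upper: "sup_norm V (T f) \<le> M" if "f \<in> S" for f
    unfolding M_def operator_norm_def S_def[symmetric]
  proof (rule cSUP_upper[OF that])
    have "sup_norm V (T f) \<le> C * 1" if "f \<in> S" for f
      using C(2)[of f] mult_left_mono[OF _ C(1), of "sup_norm V f" 1] that by (auto simp: S_def)
    then show "bdd_above ((\<lambda>f. sup_norm V (T f)) ` S)" by (auto simp: bdd_above_def)
  qed
  have M_approx: "\<exists>f\<in>S. b < sup_norm V (T f)" if "b < M" for b
  proof (rule ccontr)
    assume "\<not> ?thesis"
    then have "M \<le> b"
      unfolding M_def operator_norm_def S_def[symmetric]
      using zero_mem by (intro cSUP_least) (auto simp: not_less)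
    with that show False by simp
  qed
  have upper: "sup_norm V (T f + f) \<le> 1 + M" if f: "f \<in> S" for f
  proof (rule sup_norm_le[OF ne])
    fix x assume x: "x \<in> V"
    have "cmod (T f x) \<le> M" "cmod (f x) \<le> 1"
      using M_upper[OF f] norm_le_sup_norm[OF \<A> T_mem x, of f] norm_le_sup_norm[OF \<A> _ x, of f] f
      by (auto simp: S_def)
    then show "cmod ((T f + f) x) \<le> 1 + M"
      using norm_triangle_ineq[of "T f x" "f x"] by (simp add: plus_fun_def)
  qed
  obtain g where g: "g \<in> T ` \<A>" "g \<noteq> 0" "\<And>f. f \<in> \<A> \<Longrightarrow> \<exists>k. T f = fun_scale k g"
    using one_dimensional_range[OF rank] by blast
  then have g_mem: "g \<in> \<A>" using T_mem by auto
  obtain p where p: "g p \<noteq> 0" using g(2) by (auto simp: fun_eq_iff)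
  have pV: "p \<in> V" using p g_mem algebra_subset_H_inf[OF \<A>] by (auto simp: H_inf_def)
  \<comment> \<open>As all values of \<^term>\<open>T\<close> are multiples of \<^term>\<open>g\<close>, they are controlled by their
    value at \<^term>\<open>p\<close>. So evaluation at \<^term>\<open>p\<close> after \<^term>\<open>T\<close> takes the role of the
    functional that defines \<^term>\<open>T\<close>.\<close>
  define L where "L = sup_norm V g / cmod (g p)"
  have T_le: "cmod (T h x) \<le> L * cmod (T h p)" if h: "h \<in> \<A>" and x: "x \<in> V" for h x
  proof -
    obtain k where k: "T h = fun_scale k g" using g(3)[OF h] by blast
    show ?thesis
      using norm_le_sup_norm[OF \<A> g_mem x] p
      by (simp add: k fun_scale_def L_def norm_mult mult_left_mono mult.commute)
  qed
  have L: "L \<ge> 0" using pos[OF g_mem] by (simp add: L_def)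
  have M_pos: "M > 0"
  proof -
    obtain f where f: "f \<in> \<A>" "g = T f" using g(1) by blast
    define c :: complex where "c = of_real (1 / (1 + sup_norm V f))"
    have s: "1 + sup_norm V f > 0" using pos[OF f(1)] by simp
    have cf: "(\<lambda>x. c * f x) \<in> S"
      unfolding S_def mem_Collect_eq
    proof (intro conjI sup_norm_le[OF ne])
      show "cmod (c * f x) \<le> 1" if "x \<in> V" for x
        using norm_le_sup_norm[OF \<A> f(1) that] s
        by (simp add: c_def norm_mult norm_divide field_simps del: of_real_add)
    qed (use f algebra_scale[OF \<A>] in auto)
    have "0 < cmod (c * g p)" using p s by (simp add: c_def norm_divide flip: of_real_add)
    also have "\<dots> \<le> sup_norm V (T (\<lambda>x. c * f x))"
      using norm_le_sup_norm[OF \<A> T_mem pV, of "\<lambda>x. c * f x"] cf f by (simp add: T_scale S_def)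
    finally show ?thesis using M_upper[OF cf] by linarith
  qed
  define Q where "Q = operator_norm \<A> (sup_norm V) (\<lambda>x. T x + x)"
  have Q_upper: "sup_norm V (T f + f) \<le> Q" if "f \<in> S" for f
    unfolding Q_def operator_norm_def S_def[symmetric]
    using upper by (intro cSUP_upper[OF that]) (auto simp: bdd_above_def)
  have estimate: "1 + M - 3 * \<epsilon> \<le> (1 + \<epsilon>) * Q" if \<epsilon>: "0 < \<epsilon>" "\<epsilon> < M" for \<epsilon>
  proof -
    obtain f where f: "f \<in> S" "M - \<epsilon> < sup_norm V (T f)" using M_approx[of "M - \<epsilon>"] \<epsilon> by auto
    have f_mem: "f \<in> \<A>" using f by (simp add: S_def)
    obtain x0 where x0: "x0 \<in> V" "M - \<epsilon> < cmod (T f x0)"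
      using sup_norm_le[OF ne, of "T f" "M - \<epsilon>"] f(2) by (meson not_le)
    have f_le: "cmod (f x) \<le> 1" if "x \<in> V" for x
      using norm_le_sup_norm[OF \<A> f_mem that] f(1) by (simp add: S_def)
    \<comment> \<open>Small enough both as an error and after multiplication by \<^term>\<open>L\<close>.\<close>
    define \<delta> where "\<delta> = \<epsilon> / (1 + L)"
    have \<delta>: "0 < \<delta>" "\<delta> \<le> \<epsilon>" "L * \<delta> \<le> \<epsilon>"
      using \<epsilon> L by (auto simp: \<delta>_def field_simps)
    obtain h y where h: "h \<in> \<A>" "y \<in> V" "\<And>x. x \<in> V \<Longrightarrow> cmod (f x + h x) \<le> 1 + \<delta>"
      "cmod (T h p) \<le> \<delta>" "(M - \<epsilon>) + 1 - \<delta> \<le> cmod (T f y + (f y + h y))"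
    proof (rule spike_perturbation[OF assms, of "\<lambda>f. T f p" C f "T f" x0 "M - \<epsilon>" \<delta>])
      show "cmod (T f p) \<le> C * sup_norm V f" if "f \<in> \<A>" for f
        using norm_le_sup_norm[OF \<A> T_mem[OF that] pV] C(2)[OF that] by linarith
    qed (use T_add T_scale T_mem f_mem f_le x0 \<epsilon> \<delta> C in auto)
    \<comment> \<open>The perturbed function has norm at most \<^term>\<open>1 + \<epsilon>\<close> and is scaled back into the
      unit ball.\<close>
    define c :: complex where "c = of_real (1 / (1 + \<epsilon>))"
    define w where "w x = c * (f x + h x)" for x
    have c: "cmod c = 1 / (1 + \<epsilon>)" using \<epsilon> by (simp add: c_def norm_divide flip: of_real_add)
    have fh: "(\<lambda>x. f x + h x) \<in> \<A>" by (intro algebra_add[OF \<A>] f_mem h)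
    have "w \<in> S"
      unfolding S_def mem_Collect_eq
    proof (intro conjI sup_norm_le[OF ne])
      show "w \<in> \<A>" unfolding w_def by (intro algebra_scale[OF \<A>] fh)
      show "cmod (w x) \<le> 1" if "x \<in> V" for x
        using h(3)[OF that] \<delta> \<epsilon> unfolding w_def norm_mult c by simp
    qed
    have "T w y = c * (T f y + T h y)"
      unfolding w_def T_scale[OF fh] T_add[OF f_mem h(1)] ..
    then have "(T w + w) y = c * ((T f y + (f y + h y)) + T h y)"
      by (simp add: w_def algebra_simps)
    then have "cmod (T f y + (f y + h y) + T h y) / (1 + \<epsilon>) = cmod ((T w + w) y)"
      by (simp add: norm_mult c)
    also have "\<dots> \<le> Q"
    proof -
      have "(\<lambda>x. T w x + w x) \<in> \<A>"
        using \<open>w \<in> S\<close> by (intro algebra_add[OF \<A>] T_mem) (auto simp: S_def)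
      then have "T w + w \<in> \<A>" by (simp add: plus_fun_def)
      then show ?thesis
        by (rule order_trans[OF norm_le_sup_norm[OF \<A> _ h(2)] Q_upper[OF \<open>w \<in> S\<close>]])
    qed
    finally have "cmod (T f y + (f y + h y) + T h y) \<le> (1 + \<epsilon>) * Q"
      using \<epsilon> by (simp add: field_simps)
    moreover have "cmod (T h y) \<le> \<epsilon>"
      using T_le[OF h(1,2)] mult_left_mono[OF h(4) L] \<delta>(3) by linarith
    moreover have "cmod (T f y + (f y + h y)) - cmod (T h y) \<le> cmod (T f y + (f y + h y) + T h y)"
      using norm_diff_ineq .
    ultimately show ?thesis using h(5) \<delta>(2) by linarith
  qed
  have "1 + M \<le> Q"
  proof (rule tendsto_le[of "at_right 0"])
    show "((\<lambda>\<epsilon>. (1 + \<epsilon>) * Q) \<longlongrightarrow> Q) (at_right 0)" by (auto intro!: tendsto_eq_intros)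
    show "((\<lambda>\<epsilon>. 1 + M - 3 * \<epsilon>) \<longlongrightarrow> 1 + M) (at_right 0)" by (auto intro!: tendsto_eq_intros)
    show "eventually (\<lambda>\<epsilon>. 1 + M - 3 * \<epsilon> \<le> (1 + \<epsilon>) * Q) (at_right 0)"
      using estimate M_pos by (auto simp: eventually_at_right_field)
  qed auto
  moreover have "Q \<le> 1 + M"
    unfolding Q_def operator_norm_def S_def[symmetric]
    using upper zero_mem by (intro cSUP_least) auto
  ultimately show "operator_norm \<A> (sup_norm V) (\<lambda>x. T x + x) = 1 + operator_norm \<A> (sup_norm V) T"
    by (simp add: Q_def M_def)
qed

end
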